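(* Let $(V_1,\dotsc,V_n)$ be an $n$-tuple of doubly non-commuting isometries on a Hilbert space $H$. Then the following are equivalent: (1) $H$ has only trivial subspaces that are invariant under the C*-algebra that is generated by the operators in the $n$-tuple $(V_1,\dotsc,V_n)$; (2) There exists a (possibly empty) set of indices $A\subseteq\{1,\dotsc,n\}$ such that $(V_1,\dotsc,V_n)$ is unitarily equivalent to a standard $n$-tuple with $A$-wandering data, with the property that the $A$-wandering subspace $W_A$ of the pertinent Hilbert space has only trivial subspaces that are invariant under the C*-algebra of operators on $W_A$ that is generated by the operators in the $A$-wandering data $\mathcal{D}_A$ of this standard $n$-tuple. In that case, if $H\neq\{0\}$, two such $n$-tuples are unitarily equivalent if and only if the corresponding sets of indices in part (2) are equal and the wandering data for these equal sets of indices are unitarily equivalent.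
   Context: Let $n\geq 1$ and let $z_{ij}\in\mathbb{T}$ ($1\leq i,j\leq n$, $i\neq j$) with $z_{ji}=\overline{z}_{ij}$. An $n$-tuple $(V_1,\dotsc,V_n)$ of isometries on a Hilbert space $H$ is an $n$-tuple of doubly non-commuting isometries if $V_i^\ast V_j=\overline{z}_{ij}V_jV_i^\ast$ for all $i\neq j$. Subspaces are closed. For a single isometry $V_i$ put $H_i^{\mathrm{iso}}=\bigoplus_{k\geq0}V_i^k(\ker V_i^\ast)$ and $H_i^{\mathrm{uni}}=\bigcap_{k\geq0}V_i^k(H)$. For $A\subseteq\{1,\dotsc,n\}$ with complement $A^{\mathrm c}=\{j_1<\dotsb<j_{n-l}\}$, set $H_A=\bigcap_{i\in A}H_i^{\mathrm{iso}}\cap\bigcap_{i\in A^{\mathrm c}}H_i^{\mathrm{uni}}$; then $H=\bigoplus_A H_A$, each $H_A$ reduces all $V_i$, $V_i|_{H_A}$ is a pure isometry for $i\in A$ and unitary for $i\in A^{\mathrm c}$. The $A$-wandering subspace is $W_A=\bigcap_{m_{j_1},\dotsc,m_{j_{n-l}}\geq0}V_{j_1}^{m_{j_1}}\dotsm V_{j_{n-l}}^{m_{j_{n-l}}}\big(\bigcap_{i\in A}\ker V_i^\ast\big)$ (for $A=\emptyset$ the inner intersection is $H$); it reduces $V_j$ for $j\in A^{\mathrm c}$, on which these act unitarily, and $H_A=\bigoplus_{k_i\geq0,\,i\in A}\prod_{i\in A}V_i^{k_i}(W_A)$. The $A$-wandering data are $\mathcal{D}_A=(\mathbf{1}_{W_A},V_{j_1}|_{W_A},\dotsc,V_{j_{n-l}}|_{W_A})$,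 listed in increasing index order. Standard $n$-tuple with $A$-wandering data $(\mathbf{1}_W,\widetilde U_{j_1},\dotsc,\widetilde U_{j_{n-l}})$: given a Hilbert space $W$ and unitaries $\widetilde U_j$ ($j\in A^{\mathrm c}$) on $W$ with $\widetilde U_i^\ast\widetilde U_j=\overline{z}_{ij}\widetilde U_j\widetilde U_i^\ast$, on $\ell^2(\mathbb{N}_0^A)\otimes W$ (orthonormal basis $e_k$, $k=(k_i)_{i\in A}$) define, for $i\in A$, $V_i(e_k\otimes x)=\big(\prod_{i'\in A,\,i'<i}z_{i,i'}^{k_{i'}}\big)e_{k+\delta_i}\otimes x$ (with $\delta_i$ raising $k_i$ by one), and for $j\in A^{\mathrm c}$, $V_j(e_k\otimes x)=\big(\prod_{i'\in A}z_{j,i'}^{k_{i'}}\big)e_k\otimes\widetilde U_jx$. This is an $n$-tuple of doubly non-commuting isometries whose $A$-wandering subspace is $e_{0}\otimes W\cong W$, with $A$-wandering data $(\mathbf{1}_W,\widetilde U_{j_1},\dotsc,\widetilde U_{j_{n-l}})$, all other wandering data being zero. Unitary equivalence of tuples means a single unitary intertwining all corresponding operators simultaneously. *)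

theory Defs
  imports "HOL-Analysis.Analysis"
begin

text \<open>A complex Hilbert space is rendered as a real Hilbert space (class real_inner + complete_space,
  with real inner product Re of the complex one) equipped with an orthogonal complex structure cJ
  (multiplication by the imaginary unit).  Complex scalar multiplication is scaleC below.\<close>

class chilbert = real_inner + complete_space +
  fixes cJ :: "'a \<Rightarrow> 'a"
  assumes cJ_add: "cJ (x + y) = cJ x + cJ y"
    and cJ_scaleR: "cJ (r *\<^sub>R x) = r *\<^sub>R cJ x"
    and cJ_cJ: "cJ (cJ x) = - x"
    and cJ_inner: "inner (cJ x) (cJ y) = inner x y"

instantiation complex :: chilbert
begin
definition cJ_complex :: "complex \<Rightarrow> complex" where "cJ_complex x = \<i> * x"
instance
  by standard (auto simp: cJ_complex_def algebra_simps inner_complex_def scaleR_conv_of_real)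
end

definition scaleC :: "complex \<Rightarrow> 'a::chilbert \<Rightarrow> 'a" where
  "scaleC c x = Re c *\<^sub>R x + Im c *\<^sub>R cJ x"

definition csubspace :: "'a::chilbert set \<Rightarrow> bool" where
  "csubspace S \<longleftrightarrow> subspace S \<and> (\<forall>x\<in>S. cJ x \<in> S)"

definition closed_csubspace :: "'a::chilbert set \<Rightarrow> bool" where
  "closed_csubspace S \<longleftrightarrow> csubspace S \<and> closed S"

definition cop_on :: "'a::chilbert set \<Rightarrow> ('a \<Rightarrow> 'a) \<Rightarrow> bool" where
  "cop_on S f \<longleftrightarrow> (\<forall>x\<in>S. f x \<in> S) \<and>
     (\<forall>x\<in>S. \<forall>y\<in>S. f (x + y) = f x + f y) \<and>
     (\<forall>r. \<forall>x\<in>S. f (r *\<^sub>R x) = r *\<^sub>R f x) \<and>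
     (\<forall>x\<in>S. f (cJ x) = cJ (f x)) \<and>
     (\<exists>K. \<forall>x\<in>S. norm (f x) \<le> K * norm x)"

definition adj_on :: "'a::chilbert set \<Rightarrow> ('a \<Rightarrow> 'a) \<Rightarrow> 'a \<Rightarrow> 'a" where
  "adj_on S f = (SOME g. (\<forall>x\<in>S. g x \<in> S) \<and> (\<forall>x\<in>S. \<forall>y\<in>S. inner (f x) y = inner x (g y)))"

definition opnorm_on :: "'a::chilbert set \<Rightarrow> ('a \<Rightarrow> 'a) \<Rightarrow> real" where
  "opnorm_on S f = Sup ((\<lambda>x. norm (f x)) ` {x\<in>S. norm x \<le> 1})"

definition isometry_on :: "'a::chilbert set \<Rightarrow> ('a \<Rightarrow> 'a) \<Rightarrow> bool" where
  "isometry_on S f \<longleftrightarrow> cop_on S f \<and> (\<forall>x\<in>S. norm (f x) = norm x)"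

definition unitary_on :: "'a::chilbert set \<Rightarrow> ('a \<Rightarrow> 'a) \<Rightarrow> bool" where
  "unitary_on S f \<longleftrightarrow> isometry_on S f \<and> f ` S = S"

definition cstar_gen :: "'a::chilbert set \<Rightarrow> ('a \<Rightarrow> 'a) set \<Rightarrow> ('a \<Rightarrow> 'a) set" where
  "cstar_gen S G = \<Inter> {T. G \<subseteq> T \<and>
      (\<forall>f\<in>T. \<forall>g\<in>T. (\<lambda>x. f x + g x) \<in> T) \<and>
      (\<forall>f\<in>T. \<forall>g\<in>T. f \<circ> g \<in> T) \<and>
      (\<forall>c. \<forall>f\<in>T. (\<lambda>x. scaleC c (f x)) \<in> T) \<and>
      (\<forall>f\<in>T. adj_on S f \<in> T) \<and>
      (\<forall>F f. (\<forall>m. F m \<in> T) \<and> cop_on S f \<and>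
             (\<lambda>m. opnorm_on S (\<lambda>x. F m x - f x)) \<longlonglongrightarrow> 0 \<longrightarrow> f \<in> T)}"

definition irreducible_on :: "'a::chilbert set \<Rightarrow> ('a \<Rightarrow> 'a) set \<Rightarrow> bool" where
  "irreducible_on S G \<longleftrightarrow>
     (\<forall>M. closed_csubspace M \<and> M \<subseteq> S \<and> (\<forall>T\<in>cstar_gen S G. \<forall>x\<in>M. T x \<in> M)
          \<longrightarrow> M = {0} \<or> M = S)"

text \<open>Tuples are indexed by 1..n; z i j are the (unimodular) twisting scalars.\<close>
definition dnc_isometries :: "nat \<Rightarrow> (nat \<Rightarrow> nat \<Rightarrow> complex) \<Rightarrow> (nat \<Rightarrow> 'a::chilbert \<Rightarrow> 'a) \<Rightarrow> bool" where
  "dnc_isometries n z V \<longleftrightarrow>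
     (\<forall>i\<in>{1..n}. isometry_on UNIV (V i)) \<and>
     (\<forall>i\<in>{1..n}. \<forall>j\<in>{1..n}. i \<noteq> j \<longrightarrow>
        (\<forall>x. adj_on UNIV (V i) (V j x) = scaleC (cnj (z i j)) (V j (adj_on UNIV (V i) x))))"

text \<open>A-wandering subspace W_A.  The product V_{j_1}^{m_1}...V_{j_{n-l}}^{m_{n-l}} over the complement
  of A in increasing index order; the intersection of kernels over A is UNIV when A is empty.\<close>
definition wandering_subspace :: "nat \<Rightarrow> (nat \<Rightarrow> 'a::chilbert \<Rightarrow> 'a) \<Rightarrow> nat set \<Rightarrow> 'a set" where
  "wandering_subspace n V A =
     (\<Inter>m::nat \<Rightarrow> nat.
        (foldr (\<lambda>j f. (V j ^^ m j) \<circ> f) [j \<leftarrow> [1..<Suc n]. j \<notin> A] id)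
          ` (\<Inter>i\<in>A. {x. adj_on UNIV (V i) x = 0}))"

definition tuple_ueq :: "nat \<Rightarrow> (nat \<Rightarrow> 'a::chilbert \<Rightarrow> 'a) \<Rightarrow> (nat \<Rightarrow> 'b::chilbert \<Rightarrow> 'b) \<Rightarrow> bool" where
  "tuple_ueq n V V' \<longleftrightarrow> (\<exists>U::'a \<Rightarrow> 'b. bij U \<and> (\<forall>x y. U (x + y) = U x + U y) \<and>
      (\<forall>r x. U (r *\<^sub>R x) = r *\<^sub>R U x) \<and> (\<forall>x. U (cJ x) = cJ (U x)) \<and>
      (\<forall>x. norm (U x) = norm x) \<and> (\<forall>i\<in>{1..n}. \<forall>x. U (V i x) = V' i (U x)))"

text \<open>Unitary equivalence of the A-wandering data (1_{W_A}, V_j|W_A (j not in A)) of two tuples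
  (the identity components are intertwined by any map).\<close>
definition wandering_data_ueq :: "nat \<Rightarrow> nat set \<Rightarrow> (nat \<Rightarrow> 'a::chilbert \<Rightarrow> 'a) \<Rightarrow> (nat \<Rightarrow> 'b::chilbert \<Rightarrow> 'b) \<Rightarrow> bool" where
  "wandering_data_ueq n A V V' \<longleftrightarrow>
     (let W = wandering_subspace n V A; W' = wandering_subspace n V' A in
      \<exists>U::'a \<Rightarrow> 'b. bij_betw U W W' \<and> (\<forall>x\<in>W. \<forall>y\<in>W. U (x + y) = U x + U y) \<and>
        (\<forall>r. \<forall>x\<in>W. U (r *\<^sub>R x) = r *\<^sub>R U x) \<and> (\<forall>x\<in>W. U (cJ x) = cJ (U x)) \<and>
        (\<forall>x\<in>W. norm (U x) = norm x) \<and>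
        (\<forall>j\<in>{1..n} - A. \<forall>x\<in>W. U (V j x) = V' j (U x)))"

text \<open>The space l^2(N_0^A) (tensor) W, identified with the W-valued square-summable functions
  on N_0^A; multi-indices k in N_0^A are functions nat => nat vanishing outside A
  (e_k tensor x corresponds to the function that is x at k and 0 elsewhere).\<close>
definition std_space :: "nat set \<Rightarrow> 'w::chilbert set \<Rightarrow> ((nat \<Rightarrow> nat) \<Rightarrow> 'w) set" where
  "std_space A W = {f. (\<forall>k. f k \<in> W) \<and> (\<forall>k. (\<exists>i. i \<notin> A \<and> k i \<noteq> 0) \<longrightarrow> f k = 0) \<and>
                       (\<lambda>k. (norm (f k))\<^sup>2) summable_on UNIV}"

definition std_norm :: "((nat \<Rightarrow> nat) \<Rightarrow> 'w::chilbert) \<Rightarrow> real" where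
  "std_norm f = sqrt (\<Sum>\<^sub>\<infinity>k. (norm (f k))\<^sup>2)"

definition std_op :: "(nat \<Rightarrow> nat \<Rightarrow> complex) \<Rightarrow> nat set \<Rightarrow> (nat \<Rightarrow> 'w::chilbert \<Rightarrow> 'w) \<Rightarrow> nat
    \<Rightarrow> ((nat \<Rightarrow> nat) \<Rightarrow> 'w) \<Rightarrow> ((nat \<Rightarrow> nat) \<Rightarrow> 'w)" where
  "std_op z A Ut i f =
     (if i \<in> A then
        (\<lambda>k. if 1 \<le> k i then
               scaleC (\<Prod>i'\<in>{i'\<in>A. i' < i}. z i i' ^ (k(i := k i - 1)) i') (f (k(i := k i - 1)))
             else 0)
      else (\<lambda>k. scaleC (\<Prod>i'\<in>A. z i i' ^ k i') (Ut i (f k))))"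

definition std_irred_rep :: "nat \<Rightarrow> (nat \<Rightarrow> nat \<Rightarrow> complex) \<Rightarrow> (nat \<Rightarrow> 'a::chilbert \<Rightarrow> 'a)
    \<Rightarrow> nat set \<Rightarrow> 'w::chilbert set \<Rightarrow> (nat \<Rightarrow> 'w \<Rightarrow> 'w) \<Rightarrow> bool" where
  "std_irred_rep n z V A W Ut \<longleftrightarrow>
     A \<subseteq> {1..n} \<and> closed_csubspace W \<and>
     (\<forall>j\<in>{1..n} - A. unitary_on W (Ut j)) \<and>
     (\<forall>i\<in>{1..n} - A. \<forall>j\<in>{1..n} - A. i \<noteq> j \<longrightarrow>
        (\<forall>x\<in>W. adj_on W (Ut i) (Ut j x) = scaleC (cnj (z i j)) (Ut j (adj_on W (Ut i) x)))) \<and>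
     (\<exists>U::((nat \<Rightarrow> nat) \<Rightarrow> 'w) \<Rightarrow> 'a.
        bij_betw U (std_space A W) UNIV \<and>
        (\<forall>f\<in>std_space A W. \<forall>g\<in>std_space A W. U (\<lambda>k. f k + g k) = U f + U g) \<and>
        (\<forall>r. \<forall>f\<in>std_space A W. U (\<lambda>k. r *\<^sub>R f k) = r *\<^sub>R U f) \<and>
        (\<forall>f\<in>std_space A W. U (\<lambda>k. cJ (f k)) = cJ (U f)) \<and>
        (\<forall>f\<in>std_space A W. norm (U f) = std_norm f) \<and>
        (\<forall>i\<in>{1..n}. \<forall>f\<in>std_space A W. U (std_op z A Ut i f) = V i (U f))) \<and>
     irreducible_on W (insert id (Ut ` ({1..n} - A)))"

end

theory Submission
  imports Defs
begin

text \<open>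
A closed subspace is invariant under the generated C*-algebra iff it reduces all generators, because
the operators that leave it and its relative orthogonal complement invariant form a C*-algebra.
Put \<open>K(A) = \<Inter>i\<in>A. ker V\<^sub>i*\<close>. If \<open>M \<subseteq> K(A)\<close> reduces all \<open>V\<^sub>j\<close> with \<open>j \<notin> A\<close>, then
the orthogonal complement of all \<open>V\<^sup>k M\<close>, with \<open>k\<close> a multi-index supported on \<open>A\<close>, reduces the whole
tuple, so irreducibility makes it trivial as soon as \<open>M \<noteq> 0\<close>. Choosing \<open>A\<close> maximal with
\<open>K(A) \<noteq> 0\<close> therefore bypasses the Wold decomposition: it follows that \<open>V\<^sub>j\<close> is surjective for
\<open>j \<notin> A\<close>, that \<open>K(A)\<close> is the wandering subspace and is irreducible, and that the pairwise orthogonal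
spaces \<open>V\<^sup>k K(A)\<close> span, i.e. the tuple is the standard one.
Conversely, in a standard tuple a reducing subspace is determined by its intersection with \<open>K(A)\<close>.
Finally, \<open>A\<close> is recovered as the set of indices of the non-surjective operators.
\<close>

subsection \<open>Complex scalars and subspaces\<close>

text \<open>The defining relation only moves an adjoint past an operator. The relation
  \<open>V i (V j x) = scaleC (z i j) (V j (V i x))\<close> is derived from it and from
  unimodularity of the scalars, and it is what allows monomials in the operators to be reordered.
  With monomials written in increasing index order, the factors in \<open>std_op\<close> are exactly
  the scalars that an operator collects on the way to its slot; this is why the map sending
  \<open>f\<close> to the sum of the \<open>Vp k (f k)\<close> intertwines. Maximality of A makes an
  adjoint injective only on K(A); the passage to surjectivity of \<open>V j\<close> on the whole
  space goes through the totality of the orbit of K(A). In the zero space every index set yields a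
  standard representation, so non-surjectivity singles out A only when the space is nonzero.
  Adjoints and complements are formed with the real inner product; for \<open>cJ\<close>-linear
  operators and \<open>cJ\<close>-stable sets they coincide with the complex ones.\<close>

lemma bounded_linear_cJ: "bounded_linear (cJ :: 'a::chilbert \<Rightarrow> 'a)"
  by (rule bounded_linear_intro[where K=1]) (simp_all add: cJ_add cJ_scaleR norm_eq_sqrt_inner cJ_inner)

lemma norm_cJ [simp]: "norm (cJ x) = norm (x :: 'a::chilbert)"
  by (simp add: norm_eq_sqrt_inner cJ_inner)

lemma cJ_zero [simp]: "cJ (0 :: 'a::chilbert) = 0"
  by (rule linear_0[OF bounded_linear.linear[OF bounded_linear_cJ]])

lemma inner_cJ_left: "inner (cJ x) y = - inner x (cJ (y :: 'a::chilbert))"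
  using cJ_inner[of "cJ x" y] by (simp add: cJ_cJ)

lemma inner_cJ_right: "inner x (cJ y) = - inner (cJ x) (y :: 'a::chilbert)"
  by (simp add: inner_cJ_left)

lemma inner_cJ_self [simp]: "inner x (cJ x) = 0" "inner (cJ x) x = (0::real)" for x :: "'a::chilbert"
  using inner_cJ_left[of x x] by (simp_all add: inner_commute)

lemma scaleC_add_right: "scaleC c (x + y) = scaleC c x + scaleC c y"
  by (simp add: scaleC_def cJ_add algebra_simps)

lemma scaleC_scaleR: "scaleC c (r *\<^sub>R x) = r *\<^sub>R scaleC c x"
  by (simp add: scaleC_def cJ_scaleR algebra_simps)

lemma cJ_scaleC: "cJ (scaleC c x) = scaleC c (cJ x)"
  by (simp add: scaleC_def cJ_scaleR cJ_add)

lemma scaleC_scaleC [simp]: "scaleC a (scaleC b x) = scaleC (a * b) x"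
  by (simp add: scaleC_def cJ_scaleR cJ_add cJ_cJ algebra_simps)

lemma scaleC_one [simp]: "scaleC 1 x = x"
  by (simp add: scaleC_def)

lemma scaleC_zero [simp]: "scaleC c 0 = 0"
  by (simp add: scaleC_def)

lemma norm_scaleC [simp]: "norm (scaleC c x) = cmod c * norm x"
proof -
  have "(norm (scaleC c x))\<^sup>2 = (cmod c * norm x)\<^sup>2"
    unfolding power_mult_distrib cmod_power2 power2_norm_eq_inner
    by (simp add: scaleC_def inner_add_left inner_add_right cJ_inner power2_eq_square distrib_right)
  then show ?thesis
    by (simp add: power2_eq_iff_nonneg)
qed

lemma unimodular_cnj [simp]: "cmod c = 1 \<Longrightarrow> c * cnj c = 1" "cmod c = 1 \<Longrightarrow> cnj c * c = 1"
  by (metis complex_norm_square mult.commute of_real_1 one_power2)+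

lemma scaleC_cnj_cancel [simp]:
  "cmod c = 1 \<Longrightarrow> scaleC c (scaleC (cnj c) x) = x" "cmod c = 1 \<Longrightarrow> scaleC (cnj c) (scaleC c x) = x"
  by simp_all

lemma csubspace_scaleC: "csubspace M \<Longrightarrow> x \<in> M \<Longrightarrow> scaleC c x \<in> M"
  by (simp add: csubspace_def scaleC_def subspace_add subspace_scale)

lemma csubspace_cJ: "csubspace M \<Longrightarrow> x \<in> M \<Longrightarrow> cJ x \<in> M"
  by (simp add: csubspace_def)

lemma csubspace_0: "csubspace M \<Longrightarrow> 0 \<in> M"
  by (simp add: csubspace_def subspace_0)

lemma csubspace_add: "csubspace M \<Longrightarrow> x \<in> M \<Longrightarrow> y \<in> M \<Longrightarrow> x + y \<in> M"
  by (simp add: csubspace_def subspace_add)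

lemma csubspace_diff: "csubspace M \<Longrightarrow> x \<in> M \<Longrightarrow> y \<in> M \<Longrightarrow> x - y \<in> M"
  by (simp add: csubspace_def subspace_diff)

lemma csubspace_scaleR: "csubspace M \<Longrightarrow> x \<in> M \<Longrightarrow> r *\<^sub>R x \<in> M"
  by (simp add: csubspace_def subspace_scale)

lemmas csubspace_closure = csubspace_0 csubspace_add csubspace_diff csubspace_scaleR
  csubspace_scaleC csubspace_cJ

lemma closed_csubspace_UNIV [simp]: "closed_csubspace UNIV"
  by (simp add: closed_csubspace_def csubspace_def)

lemma closed_csubspaceD: "closed_csubspace M \<Longrightarrow> csubspace M" "closed_csubspace M \<Longrightarrow> closed M"
  by (simp_all add: closed_csubspace_def)

lemma closed_csubspace_Int: "closed_csubspace M \<Longrightarrow> closed_csubspace N \<Longrightarrow> closed_csubspace (M \<inter> N)"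
  by (auto simp: closed_csubspace_def csubspace_def subspace_Int subspace_def)

lemma closed_csubspace_INT: "(\<And>i. i \<in> I \<Longrightarrow> closed_csubspace (M i)) \<Longrightarrow> closed_csubspace (\<Inter>i\<in>I. M i)"
  by (auto simp: closed_csubspace_def csubspace_def subspace_def)

definition orth :: "'a::chilbert set \<Rightarrow> 'a set" where
  "orth M = {x. \<forall>m\<in>M. inner x m = 0}"

text \<open>\<open>cJ\<close> is skew for the real inner product, so it can be moved onto
  \<open>m\<close> without leaving \<open>M\<close>. \<open>M\<close> is a mere set because orbits,
  which are unions of subspaces, are among the instances.\<close>

lemma closed_csubspace_orth:
  assumes "\<And>m. m \<in> M \<Longrightarrow> cJ m \<in> M"
  shows "closed_csubspace (orth M)"
proof -
  have "closed (orth M)"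
  proof -
    have "orth M = (\<Inter>m\<in>M. {x. inner x m = 0})" by (auto simp: orth_def)
    moreover have "closed {x. inner x m = 0}" for m :: 'a
      by (intro closed_Collect_eq continuous_intros)
    ultimately show ?thesis by auto
  qed
  then show ?thesis
    using assms by (auto simp: closed_csubspace_def csubspace_def subspace_def orth_def inner_add_left inner_cJ_left)
qed

subsection \<open>Orthogonal projections\<close>

text \<open>Polarization. It speaks of vectors instead of a map, so that it serves isometries of a
  subspace as well as maps between different spaces.\<close>

lemma inner_eq_of_norm_eq:
  fixes x y :: "'a::real_inner" and x' y' :: "'b::real_inner"
  assumes "norm (x' + y') = norm (x + y)" "norm x' = norm x" "norm y' = norm y"
  shows "inner x' y' = inner x y"
proof -
  have "(norm (x' + y'))\<^sup>2 = (norm (x + y))\<^sup>2" "(norm x')\<^sup>2 = (norm x)\<^sup>2" "(norm y')\<^sup>2 = (norm y)\<^sup>2"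
    using assms by simp_all
  then show ?thesis
    by (simp add: power2_norm_eq_inner inner_add_left inner_add_right inner_commute)
qed

text \<open>A minimizing sequence for the distance to \<open>M\<close> is Cauchy by the
  parallelogram law; stationarity of the distance at its limit is orthogonality.\<close>

lemma orthogonal_projection_exists:
  fixes M :: "'a::{real_inner,complete_space} set"
  assumes M: "subspace M" "closed M"
  shows "\<exists>p\<in>M. \<forall>m\<in>M. inner (x - p) m = 0"
proof -
  define d where "d = infdist x M"
  have ne: "M \<noteq> {}" using subspace_0[OF M(1)] by auto
  have d_le: "d \<le> norm (x - m)" if "m \<in> M" for m
    using infdist_le[OF that, of x] by (simp add: d_def dist_norm)
  have "\<exists>m\<in>M. norm (x - m) < d + 1 / real (Suc j)" for j
  proof -
    have "\<exists>m\<in>M. dist x m < d + 1 / real (Suc j)"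
      using infdist_notempty[OF ne, of x] ne
      by (intro cINF_less_iff[THEN iffD1]) (auto simp: d_def intro!: bdd_belowI[of _ 0])
    then show ?thesis by (simp add: dist_norm)
  qed
  then obtain p where p: "\<And>j. p j \<in> M" "\<And>j. norm (x - p j) < d + 1 / real (Suc j)"
    by metis
  have d0: "d \<ge> 0" by (simp add: d_def infdist_nonneg)
  have lim: "(\<lambda>j. norm (x - p j)) \<longlonglongrightarrow> d"
  proof (rule tendsto_sandwich)
    show "\<forall>\<^sub>F j in sequentially. d \<le> norm (x - p j)" using d_le p by auto
    show "\<forall>\<^sub>F j in sequentially. norm (x - p j) \<le> d + 1 / real (Suc j)"
      by (intro always_eventually allI less_imp_le p(2))
    show "(\<lambda>j. d + 1 / real (Suc j)) \<longlonglongrightarrow> d"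
      using tendsto_add[OF tendsto_const[of d] LIMSEQ_inverse_real_of_nat]
      by (simp add: inverse_eq_divide)
  qed simp
  \<comment> \<open>Parallelogram law for \<open>x - p i\<close> and \<open>x - p j\<close>: the
    midpoint of \<open>p i\<close> and \<open>p j\<close> lies in \<open>M\<close>, hence has
    distance at least \<open>d\<close> from \<open>x\<close>.\<close>
  have par: "(norm (p i - p j))\<^sup>2 \<le> 2 * (norm (x - p i))\<^sup>2 + 2 * (norm (x - p j))\<^sup>2 - 4 * d\<^sup>2" for i j
  proof -
    have "(1/2) *\<^sub>R (p i + p j) \<in> M" using p M by (simp add: subspace_add subspace_scale)
    then have "d \<le> norm (x - (1/2) *\<^sub>R (p i + p j))" by (rule d_le)
    then have "d\<^sup>2 \<le> (norm (x - (1/2) *\<^sub>R (p i + p j)))\<^sup>2" using d0 by (simp add: power_mono)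
    moreover have "4 * (norm (x - (1/2) *\<^sub>R (p i + p j)))\<^sup>2 + (norm (p i - p j))\<^sup>2
        = 2 * (norm (x - p i))\<^sup>2 + 2 * (norm (x - p j))\<^sup>2"
      unfolding power2_norm_eq_inner by (simp add: algebra_simps inner_commute)
    ultimately show ?thesis by linarith
  qed
  have "Cauchy p"
  proof (rule metric_CauchyI)
    fix e :: real assume e: "e > 0"
    have "(\<lambda>j. (norm (x - p j))\<^sup>2) \<longlonglongrightarrow> d\<^sup>2" by (intro tendsto_intros lim)
    then have "\<forall>\<^sub>F j in sequentially. (norm (x - p j))\<^sup>2 < d\<^sup>2 + e\<^sup>2 / 4"
      using e by (intro order_tendstoD(2)) auto
    then obtain N where N: "\<And>j. j \<ge> N \<Longrightarrow> (norm (x - p j))\<^sup>2 < d\<^sup>2 + e\<^sup>2 / 4"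
      by (auto simp: eventually_sequentially)
    show "\<exists>N. \<forall>m\<ge>N. \<forall>n\<ge>N. dist (p m) (p n) < e"
    proof (intro exI allI impI)
      fix m n assume "m \<ge> N" "n \<ge> N"
      then have "(norm (p m - p n))\<^sup>2 < e\<^sup>2"
        using N[of m] N[of n] par[of m n] by linarith
      then show "dist (p m) (p n) < e"
        using e by (simp add: dist_norm power_less_imp_less_base)
    qed
  qed
  then obtain q where q: "p \<longlonglongrightarrow> q" using Cauchy_convergent convergent_def by blast
  have qM: "q \<in> M" using M(2) p(1) q closed_sequentially by blast
  have nq: "norm (x - q) = d"
    using tendsto_norm[OF tendsto_diff[OF tendsto_const q]] lim LIMSEQ_unique by blast
  have "inner (x - q) m = 0" if m: "m \<in> M" for m
  proof (cases "m = 0")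
    case False
    \<comment> \<open>This \<open>t\<close> minimizes the quadratic polynomial
      \<open>norm (x - (q + t *\<^sub>R m))\<close> squared; a strict gain would contradict the
      minimality of \<open>q\<close>.\<close>
    define t where "t = inner (x - q) m / inner m m"
    have mm: "inner m m > 0" using False by simp
    have "q + t *\<^sub>R m \<in> M" using qM m M by (simp add: subspace_add subspace_scale)
    then have "d \<le> norm (x - (q + t *\<^sub>R m))" by (rule d_le)
    then have "(norm (x - q))\<^sup>2 \<le> (norm (x - (q + t *\<^sub>R m)))\<^sup>2" using d0 nq by (simp add: power_mono)
    also have "\<dots> = (norm (x - q))\<^sup>2 - 2 * t * inner (x - q) m + t\<^sup>2 * inner m m"
      unfolding power2_norm_eq_inner by (simp add: algebra_simps inner_commute power2_eq_square)
    also have "\<dots> = (norm (x - q))\<^sup>2 - (inner (x - q) m)\<^sup>2 / inner m m"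
      using mm by (simp add: t_def power2_eq_square)
    finally have "(inner (x - q) m)\<^sup>2 / inner m m \<le> 0" by linarith
    then show ?thesis using mm by (simp add: divide_le_0_iff not_le)
  qed simp
  then show ?thesis using qM by blast
qed

text \<open>The double complement of a closed subspace, taken relative to \<open>S\<close>: the
  residual \<open>x - p\<close> is orthogonal to \<open>x\<close> by hypothesis and to
  \<open>p\<close> by construction, hence to itself.\<close>

lemma mem_of_orthogonal_orth:
  fixes S M :: "'a::chilbert set"
  assumes "closed_csubspace S" "closed_csubspace M" "M \<subseteq> S" "x \<in> S"
    and orth: "\<And>y. y \<in> S \<Longrightarrow> y \<in> orth M \<Longrightarrow> inner x y = 0"
  shows "x \<in> M"
proof -
  obtain p where p: "p \<in> M" "\<forall>m\<in>M. inner (x - p) m = 0"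
    using orthogonal_projection_exists assms(2) by (metis closed_csubspace_def csubspace_def)
  have "x - p \<in> S" using assms p by (meson closed_csubspaceD csubspace_diff subsetD)
  moreover have "x - p \<in> orth M" using p by (simp add: orth_def)
  ultimately have "inner x (x - p) = 0" by (rule orth)
  then have "inner (x - p) (x - p) = 0" using p by (simp add: inner_diff_left inner_commute)
  then show ?thesis using p by simp
qed

text \<open>Stated relative to a closed subspace because adjoints are also formed on wandering
  subspaces. The representing vector is a multiple of the component \<open>e\<close> of
  \<open>v\<close> orthogonal to the null space \<open>N\<close>.\<close>

lemma riesz_on_subspace:
  fixes S :: "'a::{real_inner,complete_space} set"
  assumes S: "subspace S" "closed S"
    and add: "\<And>x y. x \<in> S \<Longrightarrow> y \<in> S \<Longrightarrow> \<phi> (x + y) = \<phi> x + \<phi> y"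
    and scale: "\<And>r x. x \<in> S \<Longrightarrow> \<phi> (r *\<^sub>R x) = r * \<phi> x"
    and bound: "\<And>x. x \<in> S \<Longrightarrow> \<bar>\<phi> x\<bar> \<le> K * norm x"
  shows "\<exists>a\<in>S. \<forall>x\<in>S. \<phi> x = inner x a"
proof (cases "\<forall>x\<in>S. \<phi> x = 0")
  case True
  then show ?thesis using subspace_0[OF S(1)] by (intro bexI[of _ 0]) auto
next
  case False
  then obtain v where v: "v \<in> S" "\<phi> v \<noteq> 0" by auto
  have diff: "\<phi> (x - y) = \<phi> x - \<phi> y" if "x \<in> S" "y \<in> S" for x y
    using add[of "x - y" y] that S subspace_diff by fastforce
  define N where "N = {x\<in>S. \<phi> x = 0}"
  have "subspace N" using S add scale scale[of 0 0] by (auto simp: N_def subspace_def)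
  moreover have "closed N"
  proof (rule closed_sequential_limits[THEN iffD2], intro allI impI)
    fix s l assume s: "(\<forall>n. s n \<in> N) \<and> s \<longlonglongrightarrow> l"
    then have l: "l \<in> S" using S(2) closed_sequentially by (metis (no_types, lifting) N_def mem_Collect_eq)
    have "\<bar>\<phi> l\<bar> \<le> K * norm (l - s n)" for n
      using bound[of "l - s n"] diff[of l "s n"] s l S(1) by (simp add: N_def subspace_diff)
    moreover have "(\<lambda>n. K * norm (l - s n)) \<longlonglongrightarrow> K * norm (l - l)"
      using s by (intro tendsto_intros) auto
    ultimately have "\<bar>\<phi> l\<bar> \<le> K * norm (l - l)" by (intro LIMSEQ_le_const) auto
    then show "l \<in> N" using l by (simp add: N_def)
  qed
  ultimately obtain p where p: "p \<in> N" "\<forall>m\<in>N. inner (v - p) m = 0"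
    using orthogonal_projection_exists by blast
  define e where "e = v - p"
  have pS: "p \<in> S" "\<phi> p = 0" using p by (auto simp: N_def)
  have e: "e \<in> S" "\<phi> e = \<phi> v" using diff v pS S(1) by (auto simp: e_def subspace_diff)
  have e0: "e \<noteq> 0" using e v scale[of 0 0] subspace_0[OF S(1)] by auto
  have "\<phi> x = inner x ((\<phi> e / inner e e) *\<^sub>R e)" if x: "x \<in> S" for x
  proof -
    have "x - (\<phi> x / \<phi> e) *\<^sub>R e \<in> N"
      using x e v diff[of x "(\<phi> x / \<phi> e) *\<^sub>R e"] scale[of e] S(1)
      by (simp add: N_def subspace_diff subspace_scale)
    then have "inner e (x - (\<phi> x / \<phi> e) *\<^sub>R e) = 0" using p(2) by (simp add: e_def)
    then have "inner x e = (\<phi> x / \<phi> e) * inner e e" by (simp add: inner_diff_right inner_commute)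
    then show ?thesis using e v e0 by simp
  qed
  then show ?thesis using e S(1) by (metis subspace_scale)
qed

subsection \<open>Operators on a subspace and their adjoints\<close>

lemma cop_onD:
  assumes "cop_on S f"
  shows "x \<in> S \<Longrightarrow> f x \<in> S" "x \<in> S \<Longrightarrow> y \<in> S \<Longrightarrow> f (x + y) = f x + f y"
    "x \<in> S \<Longrightarrow> f (r *\<^sub>R x) = r *\<^sub>R f x" "x \<in> S \<Longrightarrow> f (cJ x) = cJ (f x)"
  using assms unfolding cop_on_def by auto

lemma cop_onI:
  assumes "\<And>x. x \<in> S \<Longrightarrow> f x \<in> S" "\<And>x y. x \<in> S \<Longrightarrow> y \<in> S \<Longrightarrow> f (x + y) = f x + f y"
    "\<And>r x. x \<in> S \<Longrightarrow> f (r *\<^sub>R x) = r *\<^sub>R f x" "\<And>x. x \<in> S \<Longrightarrow> f (cJ x) = cJ (f x)"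
    "\<And>x. x \<in> S \<Longrightarrow> norm (f x) \<le> K * norm x"
  shows "cop_on S f"
  using assms unfolding cop_on_def by (intro conjI exI[of _ K]) simp_all

lemma cop_on_bound:
  assumes "cop_on S f"
  obtains K where "K \<ge> 0" "\<And>x. x \<in> S \<Longrightarrow> norm (f x) \<le> K * norm x"
proof -
  obtain K where K: "\<And>x. x \<in> S \<Longrightarrow> norm (f x) \<le> K * norm x"
    using assms unfolding cop_on_def by metis
  have "norm (f x) \<le> max K 0 * norm x" if "x \<in> S" for x
    using K[OF that] by (smt (verit) mult_right_mono norm_ge_zero)
  then show ?thesis using that[of "max K 0"] by simp
qed

lemma cop_on_scaleC:
  assumes "csubspace S" "cop_on S f" "x \<in> S"
  shows "f (scaleC c x) = scaleC c (f x)"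
  using assms cop_onD[OF assms(2)] by (simp add: scaleC_def csubspace_closure)

lemma cop_on_diff:
  assumes "csubspace S" "cop_on S f" "x \<in> S" "y \<in> S"
  shows "f (x - y) = f x - f y"
  using cop_onD(2)[OF assms(2), of "x - y" y] assms by (simp add: csubspace_closure algebra_simps)

lemma cop_on_UNIV:
  "cop_on UNIV f \<longleftrightarrow> bounded_linear f \<and> (\<forall>x. f (cJ x) = cJ (f x))"
proof
  assume f: "cop_on UNIV f"
  obtain K where K: "\<And>x. x \<in> UNIV \<Longrightarrow> norm (f x) \<le> K * norm x"
    using f by (rule cop_on_bound) blast
  then show "bounded_linear f \<and> (\<forall>x. f (cJ x) = cJ (f x))"
    using cop_onD[OF f] K by (intro conjI bounded_linear_intro[where K=K]) (simp_all add: mult.commute)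
next
  assume f: "bounded_linear f \<and> (\<forall>x. f (cJ x) = cJ (f x))"
  then interpret bounded_linear f by simp
  obtain K where "\<And>x. norm (f x) \<le> norm x * K" using bounded by blast
  then show "cop_on UNIV f"
    using f by (intro cop_onI[where K=K]) (auto simp: add scaleR mult.commute)
qed

text \<open>\<open>adj_on\<close> is a Hilbert choice, so its property has to be earned by an
  existence proof: Riesz representation of \<open>x\<close> mapped to \<open>inner (f x) y\<close>.
  On \<open>S\<close> the choice is unique, outside it is arbitrary.\<close>

lemma adj_on_spec:
  assumes S: "closed_csubspace S" and f: "cop_on S f"
  shows "(\<forall>x\<in>S. adj_on S f x \<in> S) \<and> (\<forall>x\<in>S. \<forall>y\<in>S. inner (f x) y = inner x (adj_on S f y))"
proof -
  obtain K where K: "K \<ge> 0" "\<And>x. x \<in> S \<Longrightarrow> norm (f x) \<le> K * norm x" using f by (rule cop_on_bound) blast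
  have "\<exists>a\<in>S. \<forall>x\<in>S. inner (f x) y = inner x a" for y
  proof (rule riesz_on_subspace)
    show "subspace S" "closed S" using S by (auto simp: closed_csubspace_def csubspace_def)
    show "\<bar>inner (f x) y\<bar> \<le> (K * norm y) * norm x" if "x \<in> S" for x
      using Cauchy_Schwarz_ineq2[of "f x" y] K(2)[OF that] mult_right_mono[of "norm (f x)" "K * norm x" "norm y"]
      by (simp add: mult.commute mult.left_commute)
  qed (use cop_onD[OF f] in \<open>auto simp: inner_add_left\<close>)
  then have "\<exists>g. (\<forall>x\<in>S. g x \<in> S) \<and> (\<forall>x\<in>S. \<forall>y\<in>S. inner (f x) y = inner x (g y))" by metis
  then show ?thesis unfolding adj_on_def by (rule someI_ex)
qed

lemma adj_on_mem: "closed_csubspace S \<Longrightarrow> cop_on S f \<Longrightarrow> x \<in> S \<Longrightarrow> adj_on S f x \<in> S"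
  using adj_on_spec by blast

lemma inner_adj_on:
  "closed_csubspace S \<Longrightarrow> cop_on S f \<Longrightarrow> x \<in> S \<Longrightarrow> y \<in> S \<Longrightarrow> inner (f x) y = inner x (adj_on S f y)"
  using adj_on_spec by blast

lemma eq_of_inner_eq:
  assumes "csubspace S" "a \<in> S" "b \<in> S" "\<And>x. x \<in> S \<Longrightarrow> inner x a = inner x b"
  shows "a = b"
proof -
  have "inner (a - b) a = inner (a - b) b" using assms by (meson csubspace_diff)
  then have "inner (a - b) (a - b) = 0" by (simp add: inner_diff_right)
  then show ?thesis by simp
qed

lemma adj_on_eqI:
  assumes "closed_csubspace S" "cop_on S f" "y \<in> S" "w \<in> S" "\<And>x. x \<in> S \<Longrightarrow> inner (f x) y = inner x w"
  shows "adj_on S f y = w"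
  using assms inner_adj_on[OF assms(1,2)] adj_on_mem[OF assms(1,2)]
  by (intro eq_of_inner_eq[of S]) (auto dest: closed_csubspaceD)

lemma cop_on_adj_on:
  assumes S: "closed_csubspace S" and f: "cop_on S f"
  shows "cop_on S (adj_on S f)"
proof -
  note cs = closed_csubspaceD(1)[OF S]
  obtain K where K: "K \<ge> 0" "\<And>x. x \<in> S \<Longrightarrow> norm (f x) \<le> K * norm x" using f by (rule cop_on_bound) blast
  have "norm (adj_on S f y) \<le> K * norm y" if y: "y \<in> S" for y
  proof -
    let ?a = "adj_on S f y"
    have a: "?a \<in> S" using adj_on_mem[OF S f y] .
    \<comment> \<open>Testing the adjoint against its own value shows that it inherits the bound
      \<open>K\<close> of \<open>f\<close>.\<close>
    have "norm ?a * norm ?a = inner (f ?a) y"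
      using inner_adj_on[OF S f a y] by (simp add: norm_eq_square power2_norm_eq_inner power2_eq_square[symmetric])
    also have "\<dots> \<le> norm (f ?a) * norm y" by (rule norm_cauchy_schwarz)
    also have "\<dots> \<le> K * norm ?a * norm y" using K(2)[OF a] by (intro mult_right_mono) auto
    finally show ?thesis
      using K(1) by (cases "?a = 0") (auto simp: mult.commute mult.left_commute)
  qed
  moreover have "adj_on S f (x + y) = adj_on S f x + adj_on S f y" if "x \<in> S" "y \<in> S" for x y
    using that cs adj_on_mem[OF S f] inner_adj_on[OF S f]
    by (intro adj_on_eqI[OF S f]) (auto simp: inner_add_right csubspace_closure)
  moreover have "adj_on S f (r *\<^sub>R x) = r *\<^sub>R adj_on S f x" if "x \<in> S" for x r
    using that cs adj_on_mem[OF S f] inner_adj_on[OF S f]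
    by (intro adj_on_eqI[OF S f]) (auto simp: csubspace_closure)
  moreover have "adj_on S f (cJ x) = cJ (adj_on S f x)" if "x \<in> S" for x
    using that cs adj_on_mem[OF S f] inner_adj_on[OF S f] cop_onD[OF f]
    by (intro adj_on_eqI[OF S f]) (auto simp: csubspace_closure inner_cJ_right simp flip: cop_onD(4)[OF f])
  ultimately show ?thesis
    using adj_on_mem[OF S f] by (intro cop_onI[where K=K]) blast+
qed

lemma orth_invariant:
  assumes S: "closed_csubspace S" and f: "cop_on S f" and M: "M \<subseteq> S"
    and inv: "\<And>x. x \<in> M \<Longrightarrow> adj_on S f x \<in> M" and y: "y \<in> S" "y \<in> orth M"
  shows "f y \<in> orth M"
  using inner_adj_on[OF S f y(1)] inv y M by (auto simp: orth_def)

subsection \<open>Invariant subspaces of the generated C*-algebra\<close>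

text \<open>The supremum in \<open>opnorm_on\<close> is meaningful because \<open>f\<close> is
  bounded on the unit ball of \<open>S\<close>; the estimate then comes from normalizing
  \<open>x\<close>.\<close>

lemma norm_le_opnorm_on:
  assumes S: "csubspace S" and f: "cop_on S f" and x: "x \<in> S"
  shows "norm (f x) \<le> opnorm_on S f * norm x"
proof (cases "x = 0")
  case True
  then show ?thesis using cop_onD(3)[OF f x, of 0] by simp
next
  case False
  obtain K where K: "K \<ge> 0" "\<And>x. x \<in> S \<Longrightarrow> norm (f x) \<le> K * norm x" using f by (rule cop_on_bound) blast
  have "norm (f ((1 / norm x) *\<^sub>R x)) \<le> opnorm_on S f"
    unfolding opnorm_on_def
  proof (rule cSup_upper)
    show "bdd_above ((\<lambda>x. norm (f x)) ` {x \<in> S. norm x \<le> 1})"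
    proof (rule bdd_aboveI2)
      fix y assume "y \<in> {x \<in> S. norm x \<le> 1}"
      then show "norm (f y) \<le> K" using K(2)[of y] mult_left_mono[of "norm y" 1 K] K(1) by auto
    qed
    show "norm (f ((1 / norm x) *\<^sub>R x)) \<in> (\<lambda>x. norm (f x)) ` {x \<in> S. norm x \<le> 1}"
      using False x S by (intro imageI) (simp add: csubspace_closure)
  qed
  then show ?thesis using cop_onD(3)[OF f x] False by (simp add: divide_le_eq)
qed

lemma cop_on_plus:
  assumes "csubspace S" "cop_on S f" "cop_on S g"
  shows "cop_on S (\<lambda>x. f x + g x)"
proof -
  obtain K where "\<And>x. x \<in> S \<Longrightarrow> norm (f x) \<le> K * norm x" using assms(2) by (rule cop_on_bound) blast
  moreover obtain L where "\<And>x. x \<in> S \<Longrightarrow> norm (g x) \<le> L * norm x" using assms(3) by (rule cop_on_bound) blast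
  ultimately have "norm (f x + g x) \<le> (K + L) * norm x" if "x \<in> S" for x
    using that norm_triangle_ineq[of "f x" "g x"] by (fastforce simp: distrib_right)
  then show ?thesis
    using cop_onD[OF assms(2)] cop_onD[OF assms(3)] assms(1)
    by (intro cop_onI[where K="K + L"]) (auto simp: csubspace_closure scaleR_add_right cJ_add)
qed

lemma cop_on_compose:
  assumes "cop_on S f" "cop_on S g"
  shows "cop_on S (f \<circ> g)"
proof -
  obtain K where K: "K \<ge> 0" "\<And>x. x \<in> S \<Longrightarrow> norm (f x) \<le> K * norm x" using assms(1) by (rule cop_on_bound) blast
  obtain L where L: "\<And>x. x \<in> S \<Longrightarrow> norm (g x) \<le> L * norm x" using assms(2) by (rule cop_on_bound) blast
  have "norm (f (g x)) \<le> (K * L) * norm x" if "x \<in> S" for x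
    using K(2)[of "g x"] L[OF that] cop_onD(1)[OF assms(2) that] mult_left_mono[OF L[OF that] K(1)]
    by (simp add: mult.assoc)
  then show ?thesis
    using cop_onD[OF assms(1)] cop_onD[OF assms(2)]
    by (intro cop_onI[where K="K * L"]) auto
qed

lemma cop_on_scaleC_left:
  assumes "csubspace S" "cop_on S f"
  shows "cop_on S (\<lambda>x. scaleC c (f x))"
proof -
  obtain K where "\<And>x. x \<in> S \<Longrightarrow> norm (f x) \<le> K * norm x" using assms(2) by (rule cop_on_bound) blast
  then have "norm (scaleC c (f x)) \<le> (cmod c * K) * norm x" if "x \<in> S" for x
    using mult_left_mono[of "norm (f x)" "K * norm x" "cmod c"] that by (simp add: mult.assoc)
  then show ?thesis
    using cop_onD[OF assms(2)] assms(1)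
    by (intro cop_onI[where K="cmod c * K"]) (auto simp: csubspace_closure scaleC_add_right scaleC_scaleR cJ_scaleC)
qed

lemma cop_on_minus:
  assumes "csubspace S" "cop_on S f" "cop_on S g"
  shows "cop_on S (\<lambda>x. f x - g x)"
  using cop_on_plus[OF assms(1,2) cop_on_scaleC_left[OF assms(1,3), of "-1"]] by (simp add: scaleC_def)

text \<open>Norm convergence implies pointwise convergence, and a closed \<open>N\<close> contains
  the limit. It will be used with \<open>N\<close> an invariant subspace and with its relative
  complement.\<close>

lemma opnorm_limit_mem:
  assumes S: "csubspace S" and F: "\<And>m. cop_on S (F m)" and f: "cop_on S f"
    and lim: "(\<lambda>m. opnorm_on S (\<lambda>x. F m x - f x)) \<longlonglongrightarrow> 0"
    and N: "closed N" "\<And>m. F m x \<in> N" and x: "x \<in> S"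
  shows "f x \<in> N"
proof -
  have "(\<lambda>m. F m x - f x) \<longlonglongrightarrow> 0"
  proof (rule Lim_null_comparison)
    show "\<forall>\<^sub>F m in sequentially. norm (F m x - f x) \<le> opnorm_on S (\<lambda>x. F m x - f x) * norm x"
      using norm_le_opnorm_on[OF S cop_on_minus[OF S F f] x] by simp
    show "(\<lambda>m. opnorm_on S (\<lambda>x. F m x - f x) * norm x) \<longlonglongrightarrow> 0"
      using tendsto_mult[OF lim tendsto_const[of "norm x"]] by simp
  qed
  then have "(\<lambda>m. F m x) \<longlonglongrightarrow> f x" by (simp add: LIM_zero_iff)
  then show ?thesis using closed_sequentially[OF N(1), of "\<lambda>m. F m x" "f x"] N(2) by simp
qed

text \<open>Invariance of \<open>M\<close> alone is not stable under adjoints. Passing to the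
  adjoint exchanges the condition on \<open>M\<close> with the one on its complement in
  \<open>S\<close>, so the two together are stable.\<close>

lemma cstar_gen_invariant:
  assumes S: "closed_csubspace S" and G: "\<And>g. g \<in> G \<Longrightarrow> cop_on S g"
    and M: "closed_csubspace M" "M \<subseteq> S"
    and inv: "\<And>g x. g \<in> G \<Longrightarrow> x \<in> M \<Longrightarrow> g x \<in> M" "\<And>g x. g \<in> G \<Longrightarrow> x \<in> M \<Longrightarrow> adj_on S g x \<in> M"
    and T: "T \<in> cstar_gen S G" "x \<in> M"
  shows "T x \<in> M"
proof -
  let ?N = "S \<inter> orth M"
  have N: "closed_csubspace ?N"
    using S M by (intro closed_csubspace_Int closed_csubspace_orth) (auto dest: closed_csubspaceD csubspace_cJ)
  \<comment> \<open>\<open>cstar_gen\<close> intersects sets of arbitrary functions;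
    \<open>cop_on\<close> is recorded in \<open>D\<close> because the closure under adjoints and
    norm limits relies on boundedness and linearity.\<close>
  define D where "D = {f. cop_on S f \<and> (\<forall>x\<in>M. f x \<in> M) \<and> (\<forall>x\<in>?N. f x \<in> ?N)}"
  note cs = closed_csubspaceD(1)[OF S] closed_csubspaceD(1)[OF M(1)] closed_csubspaceD(1)[OF N]
  have "cstar_gen S G \<subseteq> D"
    unfolding cstar_gen_def
  proof (rule Inter_lower, rule CollectI, intro conjI ballI allI impI)
    show "G \<subseteq> D"
    proof
      fix g assume g: "g \<in> G"
      then have "g y \<in> ?N" if "y \<in> ?N" for y
        using orth_invariant[OF S G[OF g] M(2) inv(2)[OF g]] cop_onD(1)[OF G[OF g]] that by blast
      then show "g \<in> D" using g G inv(1) by (auto simp: D_def)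
    qed
  next
    fix f g assume fg: "f \<in> D" "g \<in> D"
    show "(\<lambda>x. f x + g x) \<in> D"
      using fg cop_on_plus[OF cs(1)] csubspace_add[OF cs(2)] csubspace_add[OF cs(3)] unfolding D_def by blast
    show "f \<circ> g \<in> D"
      using fg cop_on_compose[of S f g] unfolding D_def by simp
  next
    fix c f assume f: "f \<in> D"
    show "(\<lambda>x. scaleC c (f x)) \<in> D"
      using f cop_on_scaleC_left[OF cs(1)] csubspace_scaleC[OF cs(2)] csubspace_scaleC[OF cs(3)] unfolding D_def by blast
  next
    fix f assume f: "f \<in> D"
    then have fc: "cop_on S f" by (simp add: D_def)
    have "adj_on S f x \<in> M" if x: "x \<in> M" for x
    proof (rule mem_of_orthogonal_orth[OF S M])
      show "adj_on S f x \<in> S" using adj_on_mem[OF S fc] x M by blast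
      fix y assume y: "y \<in> S" "y \<in> orth M"
      then have "inner (f y) x = 0" using f x by (auto simp: D_def orth_def)
      then show "inner (adj_on S f x) y = 0"
        using inner_adj_on[OF S fc y(1)] x M by (auto simp: inner_commute)
    qed
    moreover have "adj_on S f y \<in> ?N" if y: "y \<in> ?N" for y
    proof -
      have "inner (adj_on S f y) m = 0" if m: "m \<in> M" for m
      proof -
        have "f m \<in> M" using f m by (simp add: D_def)
        then have "inner (f m) y = 0" using y by (simp add: orth_def inner_commute[of "f m"])
        then show ?thesis using inner_adj_on[OF S fc, of m y] m y M by (auto simp: inner_commute[of m])
      qed
      then show ?thesis using adj_on_mem[OF S fc] y by (simp add: orth_def)
    qed
    ultimately show "adj_on S f \<in> D" using cop_on_adj_on[OF S fc] by (simp add: D_def)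
  next
    fix F f
    assume *: "(\<forall>m. F m \<in> D) \<and> cop_on S f \<and> (\<lambda>m. opnorm_on S (\<lambda>x. F m x - f x)) \<longlonglongrightarrow> 0"
    then have F: "cop_on S (F m)" "x \<in> M \<Longrightarrow> F m x \<in> M" "x \<in> ?N \<Longrightarrow> F m x \<in> ?N" for m x
      by (auto simp: D_def)
    have "f x \<in> M" if "x \<in> M" for x
      using * F that M by (intro opnorm_limit_mem[OF cs(1), of F f]) (auto dest: closed_csubspaceD)
    moreover have "f x \<in> ?N" if "x \<in> ?N" for x
    proof (rule opnorm_limit_mem[OF cs(1), of F f])
      show "closed ?N" using closed_csubspaceD(2)[OF N] .
    qed (use * F that in auto)
    ultimately show "f \<in> D" using * by (simp add: D_def)
  qed
  then show ?thesis using T by (auto simp: D_def)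
qed

lemma cstar_gen_memI: "g \<in> G \<Longrightarrow> g \<in> cstar_gen S G" "g \<in> G \<Longrightarrow> adj_on S g \<in> cstar_gen S G"
  unfolding cstar_gen_def by simp_all blast+

lemma irreducible_on_iff:
  assumes S: "closed_csubspace S" and G: "\<And>g. g \<in> G \<Longrightarrow> cop_on S g"
  shows "irreducible_on S G \<longleftrightarrow> (\<forall>M. closed_csubspace M \<longrightarrow> M \<subseteq> S \<longrightarrow>
    (\<forall>g\<in>G. \<forall>x\<in>M. g x \<in> M \<and> adj_on S g x \<in> M) \<longrightarrow> M = {0} \<or> M = S)"
proof -
  have "(\<forall>T\<in>cstar_gen S G. \<forall>x\<in>M. T x \<in> M) \<longleftrightarrow> (\<forall>g\<in>G. \<forall>x\<in>M. g x \<in> M \<and> adj_on S g x \<in> M)"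
    if "closed_csubspace M" "M \<subseteq> S" for M
  proof (intro iffI ballI conjI)
    fix g x assume *: "\<forall>T\<in>cstar_gen S G. \<forall>x\<in>M. T x \<in> M" "g \<in> G" "x \<in> M"
    show "g x \<in> M" "adj_on S g x \<in> M"
      using *(1)[rule_format, OF cstar_gen_memI(1)[OF *(2)] *(3)]
        *(1)[rule_format, OF cstar_gen_memI(2)[OF *(2)] *(3)] by simp_all
  next
    fix T x assume *: "\<forall>g\<in>G. \<forall>x\<in>M. g x \<in> M \<and> adj_on S g x \<in> M" "T \<in> cstar_gen S G" "x \<in> M"
    show "T x \<in> M"
      by (rule cstar_gen_invariant[OF S G that _ _ *(2,3)]) (use *(1) in auto)
  qed
  then have "(closed_csubspace M \<and> M \<subseteq> S \<and> (\<forall>T\<in>cstar_gen S G. \<forall>x\<in>M. T x \<in> M) \<longrightarrow> M = {0} \<or> M = S) \<longleftrightarrow>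
      (closed_csubspace M \<longrightarrow> M \<subseteq> S \<longrightarrow> (\<forall>g\<in>G. \<forall>x\<in>M. g x \<in> M \<and> adj_on S g x \<in> M) \<longrightarrow> M = {0} \<or> M = S)"
    for M by meson
  then show ?thesis unfolding irreducible_on_def by simp
qed

subsection \<open>Doubly non-commuting isometries\<close>

text \<open>The power of \<open>V 1\<close> stands leftmost and is applied last. Moving
  \<open>V i\<close> from the left to its slot thus crosses only powers of smaller index, which
  matches the scalars of \<open>std_op\<close>.\<close>

primrec multi_power :: "(nat \<Rightarrow> 'a \<Rightarrow> 'a) \<Rightarrow> (nat \<Rightarrow> nat) \<Rightarrow> nat \<Rightarrow> 'a \<Rightarrow> 'a" where
  "multi_power V k 0 = id"
| "multi_power V k (Suc m) = multi_power V k m \<circ> (V (Suc m) ^^ k (Suc m))"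

definition multi_indices :: "nat set \<Rightarrow> (nat \<Rightarrow> nat) set" where
  "multi_indices A = {k. \<forall>i. i \<notin> A \<longrightarrow> k i = 0}"

lemma cop_on_id: "cop_on S id"
  by (intro cop_onI[where K=1]) auto

lemma cop_on_funpow: "cop_on S f \<Longrightarrow> cop_on S (f ^^ e)"
  by (induction e) (simp_all add: cop_on_id cop_on_compose del: id_apply)

lemma cop_on_multi_power:
  "(\<And>i. i \<in> {1..m} \<Longrightarrow> cop_on S (V i)) \<Longrightarrow> cop_on S (multi_power V k m)"
proof (induction m)
  case 0
  show ?case unfolding multi_power.simps by (rule cop_on_id)
next
  case (Suc m)
  then show ?case unfolding multi_power.simps by (intro cop_on_compose cop_on_funpow) auto
qed

lemma multi_power_cong:
  "(\<And>i. i \<in> {1..m} \<Longrightarrow> k i = l i) \<Longrightarrow> multi_power V k m = multi_power V l m"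
  by (induction m) auto

lemma multi_power_zero: "(\<And>i. i \<in> {1..m} \<Longrightarrow> k i = 0) \<Longrightarrow> multi_power V k m = id"
  by (induction m) auto

lemma cop_UNIV_scaleC: "cop_on UNIV f \<Longrightarrow> f (scaleC c x) = scaleC c (f x)"
  using cop_on_scaleC[OF closed_csubspaceD(1)[OF closed_csubspace_UNIV]] by simp

lemma cop_UNIV_diff: "cop_on UNIV f \<Longrightarrow> f (x - y) = f x - f y"
  using cop_on_diff[OF closed_csubspaceD(1)[OF closed_csubspace_UNIV]] by simp

lemma cop_UNIV_zero: "cop_on UNIV f \<Longrightarrow> f 0 = 0"
  using cop_UNIV_diff[of f 0 0] by simp

lemma funpow_twisted_commute:
  assumes "cop_on UNIV W" and "\<And>x. T (W x) = scaleC c (W (T x))"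
  shows "T ((W ^^ e) x) = scaleC (c ^ e) ((W ^^ e) (T x))"
  using assms by (induction e) (auto simp: cop_UNIV_scaleC mult.commute)

text \<open>\<open>T\<close> will be some \<open>V j\<close> or its adjoint. The relation is
  required only for indices that occur in the monomial, so \<open>j\<close> itself is exempt when
  \<open>k j = 0\<close>.\<close>

lemma multi_power_twisted_commute:
  assumes "\<And>i. i \<in> {1..m} \<Longrightarrow> cop_on UNIV (V i)"
    and "\<And>i x. i \<in> {1..m} \<Longrightarrow> k i \<noteq> 0 \<Longrightarrow> T (V i x) = scaleC (c i) (V i (T x))"
  shows "T (multi_power V k m x) = scaleC (\<Prod>i\<in>{1..m}. c i ^ k i) (multi_power V k m (T x))"
  using assms
proof (induction m arbitrary: x)
  case (Suc m)
  have V: "cop_on UNIV (V (Suc m))" "cop_on UNIV (multi_power V k m)"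
    using Suc.prems by (auto intro!: cop_on_multi_power)
  have T: "T ((V (Suc m) ^^ k (Suc m)) x) = scaleC (c (Suc m) ^ k (Suc m)) ((V (Suc m) ^^ k (Suc m)) (T x))"
  proof (cases "k (Suc m) = 0")
    case False
    then show ?thesis using Suc.prems(2)[of "Suc m"] funpow_twisted_commute[OF V(1), of T] by simp
  qed simp
  have "T (multi_power V k m y) = scaleC (\<Prod>i\<in>{1..m}. c i ^ k i) (multi_power V k m (T y))" for y
    using Suc.prems by (intro Suc.IH) auto
  then show ?case using T V(2)
    by (simp add: cop_UNIV_scaleC prod.nat_ivl_Suc' mult.commute)
qed simp

locale dnc_tuple =
  fixes n :: nat and z :: "nat \<Rightarrow> nat \<Rightarrow> complex" and V :: "nat \<Rightarrow> 'a::chilbert \<Rightarrow> 'a"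
  assumes cmod_z: "\<And>i j. i \<in> {1..n} \<Longrightarrow> j \<in> {1..n} \<Longrightarrow> i \<noteq> j \<Longrightarrow> cmod (z i j) = 1"
    and dnc: "dnc_isometries n z V"
begin

abbreviation Vs :: "nat \<Rightarrow> 'a \<Rightarrow> 'a" where "Vs i \<equiv> adj_on UNIV (V i)"

abbreviation Vp :: "(nat \<Rightarrow> nat) \<Rightarrow> 'a \<Rightarrow> 'a" where "Vp k \<equiv> multi_power V k n"

lemma V_cop: "i \<in> {1..n} \<Longrightarrow> cop_on UNIV (V i)"
  using dnc by (simp add: dnc_isometries_def isometry_on_def)

lemma Vs_cop: "i \<in> {1..n} \<Longrightarrow> cop_on UNIV (Vs i)"
  by (intro cop_on_adj_on V_cop closed_csubspace_UNIV)

lemma Vp_cop: "cop_on UNIV (Vp k)"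
  by (intro cop_on_multi_power V_cop)

lemmas V_scaleC = cop_UNIV_scaleC[OF V_cop]
lemmas Vs_scaleC = cop_UNIV_scaleC[OF Vs_cop]
lemmas Vp_scaleC = cop_UNIV_scaleC[OF Vp_cop]
lemmas Vs_diff = cop_UNIV_diff[OF Vs_cop]
lemmas V_zero = cop_UNIV_zero[OF V_cop]
lemmas Vp_zero = cop_UNIV_zero[OF Vp_cop]

lemma norm_V: "i \<in> {1..n} \<Longrightarrow> norm (V i x) = norm x"
  using dnc by (simp add: dnc_isometries_def isometry_on_def)

lemma inner_Vs: "i \<in> {1..n} \<Longrightarrow> inner (V i x) y = inner x (Vs i y)"
  by (rule inner_adj_on) (auto intro: V_cop)

lemma inner_Vs': "i \<in> {1..n} \<Longrightarrow> inner x (V i y) = inner (Vs i x) y"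
  using inner_Vs[of i y x] by (simp add: inner_commute)

lemma inner_V: 
  assumes i: "i \<in> {1..n}"
  shows "inner (V i x) (V i y) = inner x y"
  using norm_V[OF i, of "x + y"] cop_onD(2)[OF V_cop[OF i]]
  by (intro inner_eq_of_norm_eq) (simp_all add: norm_V[OF i])

lemma Vs_V: 
  assumes i: "i \<in> {1..n}"
  shows "Vs i (V i x) = x"
  by (rule adj_on_eqI) (simp_all add: V_cop[OF i] inner_V[OF i])

lemma Vs_V_commute:
  "i \<in> {1..n} \<Longrightarrow> j \<in> {1..n} \<Longrightarrow> i \<noteq> j \<Longrightarrow> Vs i (V j x) = scaleC (cnj (z i j)) (V j (Vs i x))"
  using dnc by (simp add: dnc_isometries_def)

text \<open>Both sides have the norm of \<open>x\<close>, and their inner product is the squared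
  norm of \<open>x\<close> too, so their difference has norm zero. That inner product is computed by
  turning the outer \<open>V i\<close> into its adjoint, to which the defining relation
  applies.\<close>

lemma V_commute:
  assumes ij: "i \<in> {1..n}" "j \<in> {1..n}" "i \<noteq> j"
  shows "V i (V j x) = scaleC (z i j) (V j (V i x))"
proof -
  let ?a = "V i (V j x)" and ?b = "scaleC (z i j) (V j (V i x))"
  have "inner ?a ?b = inner (V j x) (Vs i ?b)" using ij by (simp add: inner_Vs)
  also have "Vs i ?b = V j x"
    using ij cmod_z[OF ij] by (simp add: Vs_scaleC Vs_V_commute Vs_V)
  finally have "inner ?a ?b = inner x x" using ij by (simp add: inner_V)
  moreover have "inner ?a ?a = inner x x" using ij by (simp add: inner_V)
  moreover have "inner ?b ?b = inner x x"
    using ij cmod_z[OF ij] by (simp add: norm_V flip: power2_norm_eq_inner)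
  ultimately have "inner (?a - ?b) (?a - ?b) = 0"
    by (simp add: inner_diff_left inner_diff_right inner_commute)
  then show ?thesis by simp
qed


lemma V_Vp_commute:
  assumes "j \<in> {1..n}" "k j = 0"
  shows "V j (Vp k x) = scaleC (\<Prod>i\<in>{1..n}. z j i ^ k i) (Vp k (V j x))"
  using assms by (intro multi_power_twisted_commute V_commute V_cop) auto

lemma Vs_Vp_commute:
  assumes "j \<in> {1..n}" "k j = 0"
  shows "Vs j (Vp k x) = scaleC (\<Prod>i\<in>{1..n}. cnj (z j i) ^ k i) (Vp k (Vs j x))"
  using assms by (intro multi_power_twisted_commute Vs_V_commute V_cop) auto

text \<open>If \<open>i\<close> is the last index, \<open>V i\<close> crosses every factor of the
  shorter monomial; otherwise the last factor is absorbed into the vector and the induction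
  hypothesis applies.\<close>

lemma V_multi_power:
  assumes "i \<in> {1..m}" "m \<le> n"
  shows "V i (multi_power V k m x) = 
    scaleC (\<Prod>j\<in>{1..<i}. z i j ^ k j) (multi_power V (k(i := Suc (k i))) m x)"
  using assms
proof (induction m arbitrary: x)
  case (Suc m)
  show ?case
  proof (cases "i = Suc m")
    case True
    have "V i (multi_power V k m y) = scaleC (\<Prod>j\<in>{1..m}. z i j ^ k j) (multi_power V k m (V i y))" for y
      using Suc.prems True by (intro multi_power_twisted_commute V_commute V_cop) auto
    moreover have "multi_power V (k(i := Suc (k i))) m = multi_power V k m"
      using True by (intro multi_power_cong) auto
    moreover have "{1..<i} = {1..m}" using True by auto
    moreover have "(k(i := Suc (k i))) (Suc m) = Suc (k i)" using True by simp
    moreover have "V i ((V (Suc m) ^^ k (Suc m)) x) = (V (Suc m) ^^ Suc (k i)) x" using True by simp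
    ultimately show ?thesis unfolding multi_power.simps o_apply by (simp only:)
  next
    case False
    then show ?thesis using Suc by simp
  qed
qed simp

lemma V_Vp:
  "i \<in> {1..n} \<Longrightarrow> V i (Vp k x) = scaleC (\<Prod>j\<in>{1..<i}. z i j ^ k j) (Vp (k(i := Suc (k i))) x)"
  by (rule V_multi_power) auto

lemma cmod_prod_z:
  assumes "i \<in> {1..n}" "J \<subseteq> {1..n}" "i \<notin> J"
  shows "cmod (\<Prod>j\<in>J. z i j ^ k j) = 1"
proof -
  have "cmod (z i j) = 1" if "j \<in> J" for j using that assms by (intro cmod_z) auto
  then show ?thesis by (simp add: norm_power flip: prod_norm)
qed

text \<open>A factor \<open>V i\<close> is pulled out on the left at the price of a scalar. The
  scalar is put on the vector, where a complex subspace absorbs it.\<close>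

lemma Vp_lower:
  assumes i: "i \<in> {1..n}" "k i \<noteq> 0"
  obtains c where "cmod c = 1" "\<And>x. Vp k x = V i (Vp (k(i := k i - 1)) (scaleC c x))"
proof
  let ?c = "\<Prod>j\<in>{1..<i}. z i j ^ k j"
  show c: "cmod (cnj ?c) = 1" using i by (subst complex_mod_cnj, intro cmod_prod_z) auto
  fix x
  let ?k = "k(i := k i - 1)"
  have "?k(i := Suc (?k i)) = k" using i by auto
  then have "V i (Vp ?k x) = scaleC (\<Prod>j\<in>{1..<i}. z i j ^ ?k j) (Vp k x)"
    using V_Vp[OF i(1), of ?k x] by (simp only:)
  also have "(\<Prod>j\<in>{1..<i}. z i j ^ ?k j) = ?c" by (intro prod.cong) auto
  finally have "scaleC (cnj ?c) (V i (Vp ?k x)) = Vp k x"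
    using c by (simp only: complex_mod_cnj scaleC_cnj_cancel)
  then show "Vp k x = V i (Vp ?k (scaleC (cnj ?c) x))"
    by (simp only: Vp_scaleC V_scaleC[OF i(1)])
qed

lemma norm_multi_power: "m \<le> n \<Longrightarrow> norm (multi_power V k m x) = norm x"
proof (induction m arbitrary: x)
  case (Suc m)
  have "norm ((V (Suc m) ^^ e) x) = norm x" for e
    using Suc.prems by (induction e) (auto simp: norm_V)
  then show ?case using Suc by simp
qed simp

lemma norm_Vp: "norm (Vp k x) = norm x"
  by (simp add: norm_multi_power)

section \<open>Joint kernels of the adjoints and their translates\<close>

definition ker :: "nat set \<Rightarrow> 'a set" where
  "ker A = (\<Inter>i\<in>A. {x. Vs i x = 0})"

lemma kerD: "x \<in> ker A \<Longrightarrow> i \<in> A \<Longrightarrow> Vs i x = 0"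
  by (simp add: ker_def)

lemma closed_csubspace_ker:
  assumes "A \<subseteq> {1..n}"
  shows "closed_csubspace (ker A)"
  unfolding ker_def
proof (rule closed_csubspace_INT)
  fix i assume "i \<in> A"
  then have i: "cop_on UNIV (Vs i)" using assms by (intro Vs_cop) auto
  then have "bounded_linear (Vs i)" by (simp add: cop_on_UNIV)
  then have "closed {x. Vs i x = 0}"
    by (intro closed_Collect_eq linear_continuous_on continuous_on_const)
  then show "closed_csubspace {x. Vs i x = 0}"
    using cop_onD[OF i] cop_UNIV_zero[OF i]
    by (auto simp: closed_csubspace_def csubspace_def subspace_def)
qed

text \<open>A commutation rule for two adjoints is avoided: testing against \<open>y\<close> turns
  it into the rule for \<open>V j\<close> and \<open>V i\<close>, after which \<open>V i\<close>
  stands outermost and its adjoint annihilates \<open>x\<close>.\<close>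

lemma ker_reducing:
  assumes A: "A \<subseteq> {1..n}" and j: "j \<in> {1..n} - A" and x: "x \<in> ker A"
  shows "V j x \<in> ker A" "Vs j x \<in> ker A"
proof -
  have *: "Vs i (V j x) = 0 \<and> Vs i (Vs j x) = 0" if i: "i \<in> A" for i
  proof
    have ij: "i \<in> {1..n}" "j \<in> {1..n}" "i \<noteq> j" "j \<noteq> i" using A i j by auto
    have x0: "Vs i x = 0" using x i by (rule kerD)
    show "Vs i (V j x) = 0" using ij x0 by (simp add: Vs_V_commute V_zero)
    have "inner (Vs i (Vs j x)) y = 0" for y
    proof -
      have "inner (Vs i (Vs j x)) y = inner x (V j (V i y))" using ij by (simp add: inner_Vs')
      also have "\<dots> = inner x (V i (scaleC (z j i) (V j y)))" using ij by (simp add: V_commute[of j i] V_scaleC)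
      also have "\<dots> = 0" using ij x0 by (simp add: inner_Vs')
      finally show ?thesis .
    qed
    then show "Vs i (Vs j x) = 0" using inner_eq_zero_iff by blast
  qed
  then show "V j x \<in> ker A" "Vs j x \<in> ker A" by (auto simp: ker_def)
qed

lemma Vs_Vp_eq_zero:
  assumes "i \<in> {1..n}" "Vs i x = 0" "k i = 0"
  shows "Vs i (Vp k x) = 0"
  using assms by (simp add: Vs_Vp_commute Vp_zero)

text \<open>At an index \<open>i\<close> of \<open>A\<close> where the exponents differ,
  \<open>V i\<close> is stripped from both monomials until the smaller exponent, \<open>m\<close> in
  the induction, is zero. The adjoint of the remaining \<open>V i\<close> then passes through the
  other monomial to its vector in \<open>ker A\<close>.\<close>

lemma Vp_orthogonal:
  assumes A: "A \<subseteq> {1..n}" and kl: "k \<in> multi_indices A" "l \<in> multi_indices A" "k \<noteq> l"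
    and w: "w \<in> ker A" "w' \<in> ker A"
  shows "inner (Vp k w) (Vp l w') = 0"
proof -
  have csub: "csubspace (ker A)" using closed_csubspace_ker[OF A] by (rule closed_csubspaceD)
  have main: "inner (Vp k w) (Vp l w') = 0"
    if "i \<in> A" "k i = m" "m < l i" "w \<in> ker A" "w' \<in> ker A" for i m k l w w'
    using that(2-)
  proof (induction m arbitrary: k l w w')
    case 0
    have i: "i \<in> {1..n}" using A \<open>i \<in> A\<close> by auto
    obtain c where "Vp l w' = V i (Vp (l(i := l i - 1)) (scaleC c w'))"
      using Vp_lower[OF i, of l] 0 by (metis not_less0)
    moreover have "Vs i (Vp k w) = 0" using 0 i \<open>i \<in> A\<close> by (intro Vs_Vp_eq_zero) (auto dest: kerD)
    ultimately show ?case using i by (simp add: inner_Vs')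
  next
    case (Suc m)
    have i: "i \<in> {1..n}" using A \<open>i \<in> A\<close> by auto
    obtain c where c: "Vp l w' = V i (Vp (l(i := l i - 1)) (scaleC c w'))"
      using Vp_lower[OF i, of l] Suc.prems by (metis not_less0)
    obtain d where d: "Vp k w = V i (Vp (k(i := k i - 1)) (scaleC d w))"
      using Vp_lower[OF i, of k] Suc.prems by (metis nat.distinct(1))
    have "inner (Vp (k(i := k i - 1)) (scaleC d w)) (Vp (l(i := l i - 1)) (scaleC c w')) = 0"
      using Suc.prems csub by (intro Suc.IH) (auto intro: csubspace_scaleC)
    then show ?case unfolding c d using inner_V[OF i] by simp
  qed
  obtain i where "k i \<noteq> l i" using kl(3) by blast
  then have "i \<in> A" using kl by (auto simp: multi_indices_def)
  from \<open>k i \<noteq> l i\<close> consider "k i < l i" | "l i < k i" by linarith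
  then show ?thesis
  proof cases
    case 1
    then show ?thesis using main[OF \<open>i \<in> A\<close> refl] w by blast
  next
    case 2
    then show ?thesis using main[OF \<open>i \<in> A\<close> refl] w by (subst inner_commute) blast
  qed
qed

text \<open>A union instead of a closed span: only its orthogonal complement matters, and that does
  not see the difference.\<close>

definition orbit :: "nat set \<Rightarrow> 'a set \<Rightarrow> 'a set" where
  "orbit A M = (\<Union>k\<in>multi_indices A. Vp k ` M)"

lemma orbit_superset: "M \<subseteq> orbit A M"
proof
  fix x assume x: "x \<in> M"
  have "(\<lambda>i. 0) \<in> multi_indices A" "Vp (\<lambda>i. 0) x = x"
    by (auto simp: multi_indices_def multi_power_zero)
  then show "x \<in> orbit A M" unfolding orbit_def using x by (metis UN_iff image_eqI)
qed

lemma orbit_scaleC: "csubspace M \<Longrightarrow> x \<in> orbit A M \<Longrightarrow> scaleC c x \<in> orbit A M"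
  unfolding orbit_def by (force simp flip: Vp_scaleC intro: csubspace_scaleC)

text \<open>Up to a scalar, \<open>V i\<close> with \<open>i\<close> in \<open>A\<close> raises the
  exponent at \<open>i\<close> and its adjoint lowers it. At exponent zero the adjoint reaches the
  vector \<open>w\<close>, where it vanishes for \<open>i\<close> in \<open>A\<close> and stays in
  \<open>M\<close> otherwise.\<close>

lemma orbit_invariant:
  assumes A: "A \<subseteq> {1..n}" and M: "csubspace M" "M \<subseteq> ker A"
    and inv: "\<And>j x. j \<in> {1..n} - A \<Longrightarrow> x \<in> M \<Longrightarrow> V j x \<in> M"
      "\<And>j x. j \<in> {1..n} - A \<Longrightarrow> x \<in> M \<Longrightarrow> Vs j x \<in> M"
    and i: "i \<in> {1..n}" and x: "x \<in> orbit A M"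
  shows "V i x \<in> orbit A M" "Vs i x \<in> orbit A M"
proof -
  obtain k w where k: "k \<in> multi_indices A" and w: "w \<in> M" and x: "x = Vp k w"
    using x by (auto simp: orbit_def)
  have mem: "scaleC c (Vp l y) \<in> orbit A M" if "l \<in> multi_indices A" "y \<in> M" for c l y
    using that by (intro orbit_scaleC M(1)) (auto simp: orbit_def)
  have Vs_w: "Vs i w \<in> M"
  proof (cases "i \<in> A")
    case True
    then have "Vs i w = 0" using w M(2) kerD by blast
    then show ?thesis using csubspace_0[OF M(1)] by simp
  next
    case False
    then show ?thesis using inv(2) i w by simp
  qed
  show "V i x \<in> orbit A M"
  proof (cases "i \<in> A")
    case True
    then have "k(i := Suc (k i)) \<in> multi_indices A" using k by (auto simp: multi_indices_def)
    then show ?thesis using w i x mem by (simp add: V_Vp)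
  next
    case False
    then have "k i = 0" using k by (auto simp: multi_indices_def)
    then show ?thesis using False inv(1)[of i w] k w i x mem by (simp add: V_Vp_commute)
  qed
  show "Vs i x \<in> orbit A M"
  proof (cases "k i = 0")
    case True
    then show ?thesis using k Vs_w i x mem by (simp add: Vs_Vp_commute)
  next
    case False
    have k': "k(i := k i - 1) \<in> multi_indices A" using k by (auto simp: multi_indices_def)
    obtain c where "x = V i (Vp (k(i := k i - 1)) (scaleC c w))"
      using Vp_lower[of i k] i False x by metis
    then have "Vs i x = scaleC c (Vp (k(i := k i - 1)) w)" using i by (simp add: Vs_V Vp_scaleC)
    then show ?thesis using mem[OF k' w] by simp
  qed
qed

lemma V_Vs:
  assumes "j \<in> {1..n}" "surj (V j)"
  shows "V j (Vs j x) = x"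
  using surjD[OF assms(2), of x] Vs_V[OF assms(1)] by auto

text \<open>As \<open>V j\<close> is an isometry, the adjoint kills \<open>y - V j (Vs j y)\<close>
  for every \<open>y\<close>.\<close>

lemma surj_of_trivial_kernel:
  assumes j: "j \<in> {1..n}" and inj: "\<And>x. Vs j x = 0 \<Longrightarrow> x = 0"
  shows "surj (V j)"
proof -
  have "V j (Vs j y) = y" for y
    using inj[of "y - V j (Vs j y)"] j by (simp add: Vs_diff Vs_V)
  then show ?thesis by (metis surj_def)
qed

section \<open>Consequences of irreducibility\<close>

lemma irreducible_iff:
  "irreducible_on UNIV (V ` {1..n}) \<longleftrightarrow> (\<forall>M. closed_csubspace M \<longrightarrow>
    (\<forall>i\<in>{1..n}. \<forall>x\<in>M. V i x \<in> M \<and> Vs i x \<in> M) \<longrightarrow> M = {0} \<or> M = UNIV)"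
  by (subst irreducible_on_iff) (auto simp: V_cop)

text \<open>Invariance of the orbit under every operator and its adjoint dualizes to the complement.
  If the complement were the whole space, then \<open>M\<close>, which lies in the orbit, would be
  orthogonal to itself.\<close>

lemma orth_orbit_trivial:
  assumes irr: "irreducible_on UNIV (V ` {1..n})"
    and A: "A \<subseteq> {1..n}" and M: "csubspace M" "M \<subseteq> ker A" "M \<noteq> {0}"
    and inv: "\<And>j x. j \<in> {1..n} - A \<Longrightarrow> x \<in> M \<Longrightarrow> V j x \<in> M"
      "\<And>j x. j \<in> {1..n} - A \<Longrightarrow> x \<in> M \<Longrightarrow> Vs j x \<in> M"
  shows "orth (orbit A M) = {0}"
proof -
  have "cJ x = scaleC \<i> x" for x :: 'a by (simp add: scaleC_def)
  then have "closed_csubspace (orth (orbit A M))"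
    by (intro closed_csubspace_orth) (simp add: orbit_scaleC M(1))
  moreover have "V i x \<in> orth (orbit A M) \<and> Vs i x \<in> orth (orbit A M)"
    if "i \<in> {1..n}" "x \<in> orth (orbit A M)" for i x
    using orbit_invariant[OF A M(1,2) inv that(1)] that
    by (auto simp: orth_def inner_Vs simp flip: inner_Vs')
  ultimately have "orth (orbit A M) = {0} \<or> orth (orbit A M) = UNIV"
    using irr unfolding irreducible_iff by blast
  moreover have "orth (orbit A M) \<noteq> UNIV"
  proof
    assume "orth (orbit A M) = UNIV"
    then have "inner m m = 0" if "m \<in> M" for m
    proof -
      have "m \<in> orth (orbit A M)" by (simp add: \<open>orth (orbit A M) = UNIV\<close>)
      moreover have "m \<in> orbit A M" using that orbit_superset by blast
      ultimately show ?thesis unfolding orth_def by blast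
    qed
    then show False using M(3) csubspace_0[OF M(1)] by auto
  qed
  ultimately show ?thesis by blast
qed

text \<open>Maximality makes the adjoint of \<open>V j\<close> injective on \<open>ker A\<close>, so
  \<open>V j\<close> maps \<open>ker A\<close> onto itself. By twisted commutation every
  \<open>Vp k w\<close> with \<open>w\<close> in \<open>ker A\<close> is then in the range of
  \<open>V j\<close>, and a vector killed by the adjoint is orthogonal to a total set.\<close>

lemma ex_wandering_indices:
  assumes irr: "irreducible_on UNIV (V ` {1..n})" and ne: "(UNIV :: 'a set) \<noteq> {0}"
  shows "\<exists>A\<subseteq>{1..n}. ker A \<noteq> {0} \<and> (\<forall>j\<in>{1..n} - A. surj (V j))"
proof -
  let ?F = "{A. A \<subseteq> {1..n} \<and> ker A \<noteq> {0}}"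
  have "finite ?F" by simp
  \<comment> \<open>The empty intersection is the whole space, so nontriviality of the space
    provides a candidate from which a maximal one exists.\<close>
  moreover have "{} \<in> ?F" using ne by (simp add: ker_def)
  ultimately have "\<exists>A\<in>?F. \<forall>B\<in>?F. A \<subseteq> B \<longrightarrow> A = B"
    by (intro finite_has_maximal) blast+
  then obtain A where A: "A \<in> ?F" and max: "\<forall>B\<in>?F. A \<subseteq> B \<longrightarrow> A = B" by (rule bexE)
  then have A': "A \<subseteq> {1..n}" "ker A \<noteq> {0}" by auto
  note csub = closed_csubspaceD(1)[OF closed_csubspace_ker[OF A'(1)]]
  have triv: "orth (orbit A (ker A)) = {0}"
    using ker_reducing[OF A'(1)] by (intro orth_orbit_trivial[OF irr A'(1) csub subset_refl A'(2)]) auto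
  have "surj (V j)" if j: "j \<in> {1..n} - A" for j
  proof -
    have jn: "j \<in> {1..n}" using j by simp
    have "ker (insert j A) = {0}"
      using max[rule_format, of "insert j A"] A' j by blast
    then have ker0: "x = 0" if "x \<in> ker A" "Vs j x = 0" for x
      using that by (auto simp: ker_def)
    have VVs: "V j (Vs j x) = x" if "x \<in> ker A" for x
    proof -
      have "x - V j (Vs j x) \<in> ker A"
        using that by (intro csubspace_diff[OF csub] ker_reducing[OF A'(1) j])
      then have "x - V j (Vs j x) = 0" by (rule ker0) (simp add: Vs_diff[OF jn] Vs_V[OF jn])
      then show ?thesis by simp
    qed
    have inj: "x = 0" if x: "Vs j x = 0" for x
    proof -
      have "inner x (Vp k w) = 0" if k: "k \<in> multi_indices A" and w: "w \<in> ker A" for k w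
      proof -
        have kj: "k j = 0" using k j by (auto simp: multi_indices_def)
        let ?c = "\<Prod>i\<in>{1..n}. z j i ^ k i"
        \<comment> \<open>Nothing is known about \<open>z j j\<close>; its exponent is zero, so its
          factor is removed before unimodularity is invoked.\<close>
        have "?c = (\<Prod>i\<in>{1..n} - {j}. z j i ^ k i)" using kj jn by (subst prod.remove[of _ j]) auto
        then have c: "cmod ?c = 1" using jn by (simp add: cmod_prod_z)
        have "Vp k w = scaleC (cnj ?c) (V j (Vp k (Vs j w)))"
          unfolding V_Vp_commute[where k=k, OF jn kj] VVs[OF w] using c by (simp only: scaleC_cnj_cancel)
        also have "\<dots> = V j (scaleC (cnj ?c) (Vp k (Vs j w)))" using jn by (simp add: V_scaleC)
        finally show ?thesis using jn x by (simp add: inner_Vs')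
      qed
      then have "x \<in> orth (orbit A (ker A))" by (auto simp: orth_def orbit_def)
      then show "x = 0" using triv by blast
    qed
    then show "surj (V j)" by (rule surj_of_trivial_kernel[OF jn])
  qed
  then show ?thesis using A' by blast
qed

lemma adj_on_ker:
  assumes A: "A \<subseteq> {1..n}" and j: "j \<in> {1..n} - A" and x: "x \<in> ker A"
  shows "cop_on (ker A) (V j)" "adj_on (ker A) (V j) x = Vs j x"
proof -
  have V: "cop_on UNIV (V j)" using j by (intro V_cop) auto
  then obtain K where "\<And>x. x \<in> UNIV \<Longrightarrow> norm (V j x) \<le> K * norm x" by (rule cop_on_bound) blast
  then show *: "cop_on (ker A) (V j)"
    using cop_onD[OF V] ker_reducing(1)[OF A j] by (intro cop_onI[where K=K]) auto
  show "adj_on (ker A) (V j) x = Vs j x"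
    using x j ker_reducing(2)[OF A j] by (intro adj_on_eqI[OF closed_csubspace_ker[OF A] *]) (auto simp: inner_Vs)
qed

text \<open>A nonzero reducing \<open>M\<close> inside \<open>ker A\<close> has a total orbit. A
  vector of \<open>ker A\<close> orthogonal to \<open>M\<close> is orthogonal to the other
  translates of \<open>M\<close> anyway, hence zero.\<close>

lemma irreducible_on_ker:
  assumes irr: "irreducible_on UNIV (V ` {1..n})" and A: "A \<subseteq> {1..n}"
  shows "irreducible_on (ker A) (insert id (V ` ({1..n} - A)))"
proof -
  note closed = closed_csubspace_ker[OF A]
  have z: "0 \<in> ker A" using closed by (simp add: closed_csubspaceD csubspace_0)
  have main: "M = {0} \<or> M = ker A"
    if M: "closed_csubspace M" "M \<subseteq> ker A"
      and inv: "\<forall>g\<in>insert id (V ` ({1..n} - A)). \<forall>x\<in>M. g x \<in> M \<and> adj_on (ker A) g x \<in> M" for M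
  proof (rule disjCI)
    assume *: "M \<noteq> ker A"
    show "M = {0}"
    proof (rule ccontr)
      assume "M \<noteq> {0}"
      have "Vs j x \<in> M" if "j \<in> {1..n} - A" "x \<in> M" for j x
        using inv[rule_format, of "V j" x] adj_on_ker(2)[OF A that(1), of x] that M(2) by auto
      then have triv: "orth (orbit A M) = {0}"
        using inv by (intro orth_orbit_trivial[OF irr A _ M(2) \<open>M \<noteq> {0}\<close>] closed_csubspaceD(1)[OF M(1)]) auto
      have "w \<in> M" if w: "w \<in> ker A" for w
      proof (rule mem_of_orthogonal_orth[OF closed M w])
        fix y assume y: "y \<in> ker A" "y \<in> orth M"
        have "inner y (Vp k m) = 0" if k: "k \<in> multi_indices A" and m: "m \<in> M" for k m
        proof (cases "k = (\<lambda>i. 0)")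
          case True
          then show ?thesis using y m by (simp add: multi_power_zero orth_def)
        next
          case False
          have "(\<lambda>i. 0) \<in> multi_indices A" by (simp add: multi_indices_def)
          then have "inner (Vp (\<lambda>i. 0) y) (Vp k m) = 0"
            using y m M(2) k False by (intro Vp_orthogonal[OF A]) auto
          then show ?thesis by (simp add: multi_power_zero)
        qed
        then have "y \<in> orth (orbit A M)" by (auto simp: orth_def orbit_def)
        then show "inner w y = 0" using triv by simp
      qed
      then show False using M(2) * by blast
    qed
  qed
  have "cop_on (ker A) g" if "g \<in> insert id (V ` ({1..n} - A))" for g
    using that adj_on_ker(1)[OF A _ z] cop_on_id by auto
  note irreducible_on_iff[OF closed this]
  then show ?thesis using main by (simp only:) (intro allI impI)
qed

end

subsection \<open>The standard model\<close>

text \<open>By the Pythagorean theorem, the partial sums over finite sets form a Cauchy net as soon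
  as those of the squared norms do; completeness gives the limit.\<close>

lemma orthogonal_family_summable:
  fixes g :: "'i \<Rightarrow> 'a::{real_inner,complete_space}"
  assumes orth: "\<And>i j. i \<noteq> j \<Longrightarrow> inner (g i) (g j) = 0"
    and sq: "(\<lambda>i. (norm (g i))\<^sup>2) summable_on UNIV"
  shows "g summable_on UNIV"
proof -
  let ?q = "\<lambda>i. (norm (g i))\<^sup>2"
  define S where "S = (\<Sum>\<^sub>\<infinity>i. ?q i)"
  have pyth: "(norm (sum g F))\<^sup>2 = sum ?q F" if "finite F" for F
    using that orth by (intro norm_sum_Pythagorean) (auto simp: pairwise_def orthogonal_def)
  have lim: "(sum ?q \<longlongrightarrow> S) (finite_subsets_at_top UNIV)"
    using sq unfolding S_def by (simp flip: has_sum_def)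
  have le_S: "sum ?q F \<le> S" if "finite F" for F
    unfolding S_def by (rule finite_sum_le_infsum[OF sq that]) auto
  have "\<exists>P. eventually P (finite_subsets_at_top UNIV) \<and>
      (\<forall>F F'. P F \<and> P F' \<longrightarrow> dist (sum g F) (sum g F') < e)" if e: "e > 0" for e
  proof -
    \<comment> \<open>Enlarging a set that misses less than the square of \<open>e/2\<close> of the
      total moves the partial sum by less than \<open>e/2\<close>; two enlargements then differ by
      less than \<open>e\<close>.\<close>
    have "\<forall>\<^sub>F F in finite_subsets_at_top UNIV. S - (e/2)\<^sup>2 < sum ?q F"
      using e by (intro order_tendstoD(1)[OF lim]) auto
    then obtain F0 where F0: "finite F0" "\<And>F. F0 \<subseteq> F \<Longrightarrow> finite F \<Longrightarrow> S - (e/2)\<^sup>2 < sum ?q F"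
      by (auto simp: eventually_finite_subsets_at_top)
    have near: "dist (sum g F0) (sum g F) < e/2" if F: "F0 \<subseteq> F" "finite F" for F
    proof -
      have "(norm (sum g (F - F0)))\<^sup>2 = sum ?q F - sum ?q F0"
        using pyth[of "F - F0"] F sum_diff[of F F0 ?q] by (simp only: finite_Diff)
      also have "\<dots> < (e/2)\<^sup>2" using le_S[OF F(2)] F0(2)[OF subset_refl F0(1)] by linarith
      finally have "norm (sum g (F - F0)) < e/2" by (rule power_less_imp_less_base) (use e in simp)
      moreover have "sum g (F - F0) = sum g F - sum g F0" using F by (simp add: sum_diff)
      ultimately show ?thesis by (simp add: dist_norm norm_minus_commute)
    qed
    have "eventually (\<lambda>F. F0 \<subseteq> F \<and> finite F) (finite_subsets_at_top UNIV)"
      using F0(1) by (auto simp: eventually_finite_subsets_at_top)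
    moreover have "dist (sum g F) (sum g F') < e"
      if "(F0 \<subseteq> F \<and> finite F) \<and> (F0 \<subseteq> F' \<and> finite F')" for F F'
      using near[of F] near[of F'] dist_triangle3[of "sum g F" "sum g F'" "sum g F0"] that by linarith
    ultimately show ?thesis by blast
  qed
  then have "cauchy_filter (filtermap (sum g) (finite_subsets_at_top UNIV))"
    by (simp add: cauchy_filter_metric_filtermap)
  moreover have "complete (UNIV :: 'a set)"
    by (meson Cauchy_convergent UNIV_I complete_def convergent_def)
  ultimately obtain L where "(sum g \<longlongrightarrow> L) (finite_subsets_at_top UNIV)"
    using complete_uniform[where S=UNIV] by (force simp add: filterlim_def)
  then show ?thesis
    using summable_on_def has_sum_def by blast
qed

lemma orthogonal_family_norm:
  fixes g :: "'i \<Rightarrow> 'a::real_inner"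
  assumes orth: "\<And>i j. i \<noteq> j \<Longrightarrow> inner (g i) (g j) = 0" and sum: "(g has_sum s) UNIV"
  shows "((\<lambda>i. (norm (g i))\<^sup>2) has_sum (norm s)\<^sup>2) UNIV"
proof -
  have pyth: "(norm (sum g F))\<^sup>2 = (\<Sum>i\<in>F. (norm (g i))\<^sup>2)" if "finite F" for F
    using that orth by (intro norm_sum_Pythagorean) (auto simp: pairwise_def orthogonal_def)
  have "((\<lambda>F. (norm (sum g F))\<^sup>2) \<longlongrightarrow> (norm s)\<^sup>2) (finite_subsets_at_top UNIV)"
    using sum unfolding has_sum_def by (intro tendsto_intros)
  then show ?thesis
    unfolding has_sum_def
    by (rule Lim_transform_eventually) (auto simp: pyth eventually_finite_subsets_at_top)
qed

lemma has_sum_singleton: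
  assumes "\<And>l. l \<noteq> k \<Longrightarrow> g l = 0"
  shows "(g has_sum g k) UNIV"
proof -
  have "(g has_sum sum g {k}) {k}" by (rule has_sum_finite) simp
  then show ?thesis using assms has_sum_cong_neutral[of UNIV "{k}" g g "g k"] by auto
qed

lemma std_spaceD:
  assumes "f \<in> std_space A W"
  shows "f k \<in> W" "k \<notin> multi_indices A \<Longrightarrow> f k = 0" "(\<lambda>k. (norm (f k))\<^sup>2) summable_on UNIV"
  using assms by (auto simp: std_space_def multi_indices_def)

lemma std_spaceI:
  assumes "\<And>k. f k \<in> W" "\<And>k. k \<notin> multi_indices A \<Longrightarrow> f k = 0" "(\<lambda>k. (norm (f k))\<^sup>2) summable_on UNIV"
  shows "f \<in> std_space A W"
  using assms by (auto simp: std_space_def multi_indices_def)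

text \<open>For \<open>i\<close> in \<open>A\<close> the functions \<open>std_op z A Ut i f\<close>
  vanish off the range of this map; its injectivity permits reindexing of sums along it.\<close>

lemma inj_increment: "inj (\<lambda>k :: nat \<Rightarrow> nat. k(i := Suc (k i)))"
proof (rule injI, rule ext)
  fix k l :: "nat \<Rightarrow> nat" and j assume "k(i := Suc (k i)) = l(i := Suc (l i))"
  then have "(k(i := Suc (k i))) j = (l(i := Suc (l i))) j" by simp
  then show "k j = l j" by (cases "j = i") auto
qed

lemma not_increment_imp_zero:
  fixes k :: "nat \<Rightarrow> nat"
  assumes "k \<notin> range (\<lambda>k. k(i := Suc (k i)))"
  shows "k i = 0"
proof (rule ccontr)
  assume "k i \<noteq> 0"
  then have "k = (\<lambda>k. k(i := Suc (k i))) (k(i := k i - 1))" by auto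
  then show False using assms by blast
qed

lemma std_op_increment:
  assumes "i \<in> A"
  shows "std_op z A Ut i f (k(i := Suc (k i))) = scaleC (\<Prod>i'\<in>{i'\<in>A. i' < i}. z i i' ^ k i') (f k)"
proof -
  let ?k = "k(i := Suc (k i))"
  have "?k(i := ?k i - 1) = k" "1 \<le> ?k i" by auto
  then show ?thesis using assms by (simp add: std_op_def del: fun_upd_apply)
qed

lemma std_op_not_increment:
  assumes "i \<in> A" "k \<notin> range (\<lambda>k. k(i := Suc (k i)))"
  shows "std_op z A Ut i f k = 0"
  using assms(1) not_increment_imp_zero[OF assms(2)] by (simp add: std_op_def)

section \<open>The intertwiner from the standard space\<close>

context dnc_tuple
begin

text \<open>The extension of the map sending the elementary tensor of e_k and \<open>w\<close> to
  \<open>Vp k w\<close>. A divergent sum would get the default value 0, so the facts about it are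
  stated on \<open>std_space A (ker A)\<close>.\<close>

definition std_sum :: "((nat \<Rightarrow> nat) \<Rightarrow> 'a) \<Rightarrow> 'a" where
  "std_sum f = (\<Sum>\<^sub>\<infinity>k. Vp k (f k))"

lemma Vp_std_orthogonal:
  assumes A: "A \<subseteq> {1..n}" and f: "f \<in> std_space A (ker A)" and kl: "k \<noteq> l"
  shows "inner (Vp k (f k)) (Vp l (f l)) = 0"
proof (cases "k \<in> multi_indices A \<and> l \<in> multi_indices A")
  case True
  then show ?thesis using std_spaceD(1)[OF f] kl by (intro Vp_orthogonal[OF A]) auto
next
  case False
  then have "f k = 0 \<or> f l = 0" using std_spaceD(2)[OF f] by blast
  then show ?thesis by (auto simp: Vp_zero)
qed

lemma has_sum_std_sum:
  assumes A: "A \<subseteq> {1..n}" and f: "f \<in> std_space A (ker A)"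
  shows "((\<lambda>k. Vp k (f k)) has_sum std_sum f) UNIV"
proof -
  have "(\<lambda>k. Vp k (f k)) summable_on UNIV"
    by (rule orthogonal_family_summable) (simp_all add: Vp_std_orthogonal[OF A f] norm_Vp std_spaceD(3)[OF f])
  then show ?thesis unfolding std_sum_def by (rule has_sum_infsum)
qed

lemma norm_std_sum:
  assumes A: "A \<subseteq> {1..n}" and f: "f \<in> std_space A (ker A)"
  shows "norm (std_sum f) = std_norm f"
proof -
  have "((\<lambda>k. (norm (f k))\<^sup>2) has_sum (norm (std_sum f))\<^sup>2) UNIV"
    using orthogonal_family_norm[OF Vp_std_orthogonal[OF A f] has_sum_std_sum[OF A f]]
    by (simp add: norm_Vp)
  then show ?thesis by (simp add: std_norm_def infsumI)
qed

lemma std_sum_add: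
  assumes "A \<subseteq> {1..n}" "f \<in> std_space A (ker A)" "g \<in> std_space A (ker A)"
  shows "std_sum (\<lambda>k. f k + g k) = std_sum f + std_sum g"
  using has_sum_add[OF has_sum_std_sum[OF assms(1,2)] has_sum_std_sum[OF assms(1,3)]]
  unfolding std_sum_def[of "\<lambda>k. f k + g k"] by (intro infsumI) (simp add: cop_onD(2)[OF Vp_cop])

lemma std_sum_scaleR:
  assumes "A \<subseteq> {1..n}" "f \<in> std_space A (ker A)"
  shows "std_sum (\<lambda>k. r *\<^sub>R f k) = r *\<^sub>R std_sum f"
  using has_sum_bounded_linear[OF bounded_linear_scaleR_right has_sum_std_sum[OF assms], of r]
  unfolding std_sum_def[of "\<lambda>k. r *\<^sub>R f k"] by (intro infsumI) (simp add: cop_onD(3)[OF Vp_cop])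

lemma std_sum_cJ:
  assumes "A \<subseteq> {1..n}" "f \<in> std_space A (ker A)"
  shows "std_sum (\<lambda>k. cJ (f k)) = cJ (std_sum f)"
  using has_sum_bounded_linear[OF bounded_linear_cJ has_sum_std_sum[OF assms]]
  unfolding std_sum_def[of "\<lambda>k. cJ (f k)"] by (intro infsumI) (simp add: cop_onD(4)[OF Vp_cop])

lemma inner_Vp: "inner (Vp k x) (Vp k y) = inner x y"
  using norm_Vp[of k "x + y"] cop_onD(2)[OF Vp_cop]
  by (intro inner_eq_of_norm_eq) (simp_all add: norm_Vp)

text \<open>Pairing with \<open>Vp k w\<close> is continuous and passes under the sum; orthogonality
  of the translates leaves the term at \<open>k\<close>, so coefficients can be read off.\<close>

lemma inner_std_sum_Vp:
  assumes A: "A \<subseteq> {1..n}" and f: "f \<in> std_space A (ker A)"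
    and k: "k \<in> multi_indices A" and w: "w \<in> ker A"
  shows "inner (std_sum f) (Vp k w) = inner (f k) w"
proof -
  let ?g = "\<lambda>l. inner (Vp l (f l)) (Vp k w)"
  have "(?g has_sum inner (std_sum f) (Vp k w)) UNIV"
    by (rule has_sum_bounded_linear[OF bounded_linear_inner_left has_sum_std_sum[OF A f]])
  moreover have "?g l = 0" if "l \<noteq> k" for l
  proof (cases "l \<in> multi_indices A")
    case True
    then show ?thesis using std_spaceD(1)[OF f] k w that by (intro Vp_orthogonal[OF A]) auto
  next
    case False
    then show ?thesis using std_spaceD(2)[OF f] by (simp add: Vp_zero)
  qed
  then have "(?g has_sum ?g k) UNIV" by (rule has_sum_singleton)
  ultimately have "inner (std_sum f) (Vp k w) = ?g k" by (rule has_sum_unique)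
  then show ?thesis by (simp add: inner_Vp)
qed

lemma inj_on_std_sum:
  assumes A: "A \<subseteq> {1..n}"
  shows "inj_on std_sum (std_space A (ker A))"
proof (rule inj_onI, rule ext)
  fix f g k
  assume f: "f \<in> std_space A (ker A)" and g: "g \<in> std_space A (ker A)" and eq: "std_sum f = std_sum g"
  note closed = closed_csubspace_ker[OF A]
  show "f k = g k"
  proof (cases "k \<in> multi_indices A")
    case True
    have "inner (f k) w = inner (g k) w" if "w \<in> ker A" for w
      using inner_std_sum_Vp[OF A f True that] inner_std_sum_Vp[OF A g True that] eq by simp
    then show ?thesis
      using std_spaceD(1)[OF f] std_spaceD(1)[OF g]
      by (intro eq_of_inner_eq[OF closed_csubspaceD(1)[OF closed]]) (auto simp: inner_commute)
  next
    case False
    then show ?thesis using std_spaceD(2)[OF f] std_spaceD(2)[OF g] by simp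
  qed
qed

text \<open>The coefficients of a preimage are Fourier coefficients; Bessel's inequality makes them square-summable.\<close>

lemma std_sum_surj:
  assumes A: "A \<subseteq> {1..n}" and triv: "orth (orbit A (ker A)) = {0}"
  shows "std_sum ` std_space A (ker A) = UNIV"
proof -
  note closed = closed_csubspace_ker[OF A]
  note csub = closed_csubspaceD(1)[OF closed]
  have "\<exists>f\<in>std_space A (ker A). std_sum f = x" for x
  proof -
    \<comment> \<open>The projection represents the functional \<open>inner x (Vp k w)\<close> of
      \<open>w\<close> by a vector of \<open>ker A\<close>; that vector is the coefficient at
      \<open>k\<close>.\<close>
    have "\<exists>p\<in>ker A. \<forall>w\<in>ker A. inner (adj_on UNIV (Vp k) x - p) w = 0" for k
      using closed by (intro orthogonal_projection_exists) (auto simp: closed_csubspace_def csubspace_def)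
    then obtain p where p: "\<And>k. p k \<in> ker A"
      "\<And>k w. w \<in> ker A \<Longrightarrow> inner (adj_on UNIV (Vp k) x - p k) w = 0" by metis
    have p_eq: "inner (p k) w = inner x (Vp k w)" if "w \<in> ker A" for k w
    proof -
      have "inner (Vp k w) x = inner w (adj_on UNIV (Vp k) x)"
        by (rule inner_adj_on) (auto simp: Vp_cop)
      moreover have "inner (p k) w = inner (adj_on UNIV (Vp k) x) w"
        using p(2)[OF that, of k] by (simp add: inner_diff_left)
      ultimately show ?thesis by (metis inner_commute)
    qed
    define f where "f k = (if k \<in> multi_indices A then p k else 0)" for k
    have f_ker: "f k \<in> ker A" for k using p(1) csubspace_0[OF csub] by (simp add: f_def)
    have f_eq: "inner (f k) w = inner x (Vp k w)" if "k \<in> multi_indices A" "w \<in> ker A" for k w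
      using p_eq that by (simp add: f_def)
    have orth: "inner (Vp k (f k)) (Vp l (f l)) = 0" if "k \<noteq> l" for k l
      using that p(1) Vp_orthogonal[OF A] by (auto simp: f_def Vp_zero)
    have bessel: "(\<Sum>k\<in>F. (norm (f k))\<^sup>2) \<le> (norm x)\<^sup>2" if F: "finite F" for F
    proof -
      let ?s = "\<Sum>k\<in>F. Vp k (f k)"
      have s: "(norm ?s)\<^sup>2 = (\<Sum>k\<in>F. (norm (f k))\<^sup>2)"
        using F orth norm_sum_Pythagorean[of F "\<lambda>k. Vp k (f k)"]
        by (simp add: pairwise_def orthogonal_def norm_Vp)
      have "inner x (Vp k (f k)) = (norm (f k))\<^sup>2" for k
      proof (cases "k \<in> multi_indices A")
        case True
        then show ?thesis using f_eq[OF True f_ker[of k]] by (simp add: power2_norm_eq_inner)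
      next
        case False
        then have "f k = 0" by (simp add: f_def)
        then show ?thesis by (simp add: Vp_zero)
      qed
      then have "inner x ?s = (norm ?s)\<^sup>2" unfolding s by (simp add: inner_sum_right)
      then have "(norm ?s)\<^sup>2 \<le> norm x * norm ?s" using norm_cauchy_schwarz[of x ?s] by simp
      then have "norm ?s \<le> norm x"
        by (cases "norm ?s = 0") (auto simp: power2_eq_square)
      then show ?thesis unfolding s[symmetric] by (simp add: power_mono)
    qed
    have "(\<lambda>k. (norm (f k))\<^sup>2) summable_on UNIV"
    proof (rule nonneg_bounded_partial_sums_imp_summable_on)
      show "\<forall>\<^sub>F F in finite_subsets_at_top UNIV. (\<Sum>k\<in>F. (norm (f k))\<^sup>2) \<le> (norm x)\<^sup>2"
        using bessel by (auto simp: eventually_finite_subsets_at_top)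
    qed simp
    then have f: "f \<in> std_space A (ker A)" using f_ker by (intro std_spaceI) (auto simp: f_def)
    have "inner (x - std_sum f) (Vp k w) = 0" if "k \<in> multi_indices A" "w \<in> ker A" for k w
      using inner_std_sum_Vp[OF A f that] f_eq[OF that] by (simp add: inner_diff_left)
    then have "x - std_sum f \<in> orth (orbit A (ker A))" by (auto simp: orth_def orbit_def)
    then show ?thesis using f triv by auto
  qed
  then show ?thesis by (auto simp: image_iff) (metis)
qed

text \<open>Reconciles the products over intervals that monomials produce with the products over
  parts of \<open>A\<close> in \<open>std_op\<close>: the additional indices carry exponent
  zero.\<close>

lemma prod_multi_index:
  assumes "k \<in> multi_indices A" "finite J" "I \<subseteq> J" "J \<inter> A \<subseteq> I"
  shows "(\<Prod>j\<in>J. (c j :: complex) ^ k j) = (\<Prod>j\<in>I. c j ^ k j)"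
  using assms by (intro prod.mono_neutral_right) (auto simp: multi_indices_def)

text \<open>Termwise this is the rule for moving \<open>V i\<close> into or past a monomial. For
  \<open>i\<close> in \<open>A\<close> the image lives on raised indices, so the series is reindexed
  along the increment.\<close>

lemma std_sum_std_op:
  assumes A: "A \<subseteq> {1..n}" and f: "f \<in> std_space A (ker A)" and i: "i \<in> {1..n}"
  shows "std_sum (std_op z A V i f) = V i (std_sum f)"
proof -
  have "bounded_linear (V i)" using V_cop[OF i] by (simp add: cop_on_UNIV)
  then have V_sum: "((\<lambda>k. V i (Vp k (f k))) has_sum V i (std_sum f)) UNIV"
    by (rule has_sum_bounded_linear[OF _ has_sum_std_sum[OF A f]])
  have f0: "f k = 0" if "k \<notin> multi_indices A" for k using std_spaceD(2)[OF f that] .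
  have "((\<lambda>k. Vp k (std_op z A V i f k)) has_sum V i (std_sum f)) UNIV"
  proof (cases "i \<in> A")
    case True
    let ?h = "\<lambda>k. k(i := Suc (k i))"
    have "V i (Vp k (f k)) = Vp (?h k) (std_op z A V i f (?h k))" for k
    proof (cases "k \<in> multi_indices A")
      case k: True
      have "{1..<i} \<inter> A \<subseteq> {i'\<in>A. i' < i}" "{i'\<in>A. i' < i} \<subseteq> {1..<i}" using A by auto
      then have "(\<Prod>j\<in>{1..<i}. z i j ^ k j) = (\<Prod>i'\<in>{i'\<in>A. i' < i}. z i i' ^ k i')"
        using k by (intro prod_multi_index) auto
      then have "std_op z A V i f (?h k) = scaleC (\<Prod>j\<in>{1..<i}. z i j ^ k j) (f k)"
        by (simp only: std_op_increment[OF True])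
      then show ?thesis by (simp only: V_Vp[OF i] Vp_scaleC)
    next
      case False
      have "std_op z A V i f (?h k) = 0"
        by (simp only: std_op_increment[OF True] f0[OF False] scaleC_zero)
      then show ?thesis using f0[OF False] i by (simp add: Vp_zero V_zero)
    qed
    then have "(((\<lambda>k. Vp k (std_op z A V i f k)) \<circ> ?h) has_sum V i (std_sum f)) UNIV"
      using V_sum by (simp add: o_def)
    then have "((\<lambda>k. Vp k (std_op z A V i f k)) has_sum V i (std_sum f)) (range ?h)"
      by (simp only: has_sum_reindex[OF inj_increment])
    moreover have "Vp k (std_op z A V i f k) = 0" if "k \<notin> range ?h" for k
      by (simp only: std_op_not_increment[OF True that] Vp_zero)
    ultimately show ?thesis
      by (subst has_sum_cong_neutral[where S = UNIV and T = "range ?h"]) auto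
  next
    case False
    have "V i (Vp k (f k)) = Vp k (std_op z A V i f k)" for k
    proof (cases "k \<in> multi_indices A")
      case k: True
      then have "k i = 0" using False by (auto simp: multi_indices_def)
      moreover have "(\<Prod>j\<in>{1..n}. z i j ^ k j) = (\<Prod>j\<in>A. z i j ^ k j)"
        using k A by (intro prod_multi_index) auto
      ultimately show ?thesis using False i by (simp add: V_Vp_commute std_op_def Vp_scaleC)
    next
      case k: False
      then show ?thesis using f0[OF k] False i by (simp add: std_op_def Vp_zero V_zero)
    qed
    then show ?thesis using V_sum by simp
  qed
  then show ?thesis unfolding std_sum_def[of "std_op z A V i f"] by (rule infsumI)
qed

text \<open>The second alternative of \<open>ne\<close> admits the zero space, where
  \<open>ker A\<close> is necessarily zero. In both cases the orbit of \<open>ker A\<close> has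
  trivial complement, which makes \<open>std_sum\<close> onto.\<close>

lemma std_irred_rep_ker:
  assumes irr: "irreducible_on UNIV (V ` {1..n})" and A: "A \<subseteq> {1..n}"
    and surj: "\<And>j. j \<in> {1..n} - A \<Longrightarrow> surj (V j)"
    and ne: "ker A \<noteq> {0} \<or> (UNIV :: 'a set) = {0}"
  shows "bij_betw std_sum (std_space A (ker A)) UNIV" "std_irred_rep n z V A (ker A) V"
proof -
  note closed = closed_csubspace_ker[OF A]
  note csub = closed_csubspaceD(1)[OF closed]
  have triv: "orth (orbit A (ker A)) = {0}"
  proof (cases "ker A = {0}")
    case True
    then have "(UNIV :: 'a set) = {0}" using ne by blast
    then have "orth (orbit A (ker A)) \<subseteq> {0}" by blast
    moreover have "0 \<in> orth (orbit A (ker A))" by (simp add: orth_def)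
    ultimately show ?thesis by blast
  next
    case False
    show ?thesis
      by (rule orth_orbit_trivial[OF irr A csub subset_refl False]) (simp_all add: ker_reducing[OF A])
  qed
  show bij: "bij_betw std_sum (std_space A (ker A)) UNIV"
    using inj_on_std_sum[OF A] std_sum_surj[OF A triv] by (simp add: bij_betw_def)
  have unitary: "unitary_on (ker A) (V j)" if j: "j \<in> {1..n} - A" for j
  proof -
    have jn: "j \<in> {1..n}" using j by simp
    have "ker A \<subseteq> V j ` ker A"
    proof
      fix x assume "x \<in> ker A"
      then show "x \<in> V j ` ker A"
        using ker_reducing(2)[OF A j] V_Vs[OF jn surj[OF j]] by (metis imageI)
    qed
    then show ?thesis
      using adj_on_ker(1)[OF A j csubspace_0[OF csub]] ker_reducing(1)[OF A j]
      by (auto simp: unitary_on_def isometry_on_def norm_V[OF jn])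
  qed
  have twist: "adj_on (ker A) (V i) (V j x) = scaleC (cnj (z i j)) (V j (adj_on (ker A) (V i) x))"
    if "i \<in> {1..n} - A" "j \<in> {1..n} - A" "i \<noteq> j" "x \<in> ker A" for i j x
    using that ker_reducing(1)[OF A that(2,4)]
    by (simp add: adj_on_ker(2)[OF A that(1)] Vs_V_commute)
  show "std_irred_rep n z V A (ker A) V"
    unfolding std_irred_rep_def
    by (intro conjI ballI allI impI exI[of _ std_sum] A closed unitary twist irreducible_on_ker[OF irr A]
        bij std_sum_add[OF A] std_sum_scaleR[OF A] std_sum_cJ[OF A] norm_std_sum[OF A] std_sum_std_op[OF A])
qed

end

subsection \<open>Tuples that are equivalent to a standard tuple\<close>

text \<open>The elementary tensor of e_k and \<open>w\<close> when \<open>w\<close> is a vector;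
  scalar families of this shape occur in norm computations.\<close>

definition single_at :: "'k \<Rightarrow> 'b::zero \<Rightarrow> 'k \<Rightarrow> 'b" where
  "single_at k w = (\<lambda>l. if l = k then w else 0)"

abbreviation zero_index :: "nat \<Rightarrow> nat" where "zero_index \<equiv> (\<lambda>i. 0)"

lemma single_at_apply [simp]: "single_at k w k = w" "l \<noteq> k \<Longrightarrow> single_at k w l = 0"
  by (simp_all add: single_at_def)

lemma zero_index_mem [simp]: "zero_index \<in> multi_indices A"
  by (simp add: multi_indices_def)

lemma has_sum_norm_single_at: "((\<lambda>l. (norm (single_at k w l))\<^sup>2) has_sum (norm w)\<^sup>2) UNIV"
  using has_sum_singleton[of k "\<lambda>l. (norm (single_at k w l))\<^sup>2"] by simp

lemma single_at_mem:
  assumes "csubspace W" "w \<in> W" "k \<in> multi_indices A"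
  shows "single_at k w \<in> std_space A W"
proof (rule std_spaceI)
  show "single_at k w l \<in> W" for l
    using assms by (simp add: single_at_def csubspace_0)
  show "single_at k w l = 0" if "l \<notin> multi_indices A" for l
    using assms that by (auto simp: single_at_def)
  show "(\<lambda>l. (norm (single_at k w l))\<^sup>2) summable_on UNIV"
    using has_sum_norm_single_at by (rule has_sum_imp_summable)
qed

text \<open>With \<open>x = f y\<close>, preservation of inner products on \<open>S\<close> shows
  that \<open>y\<close> has the characteristic property of the adjoint at \<open>x\<close>.\<close>

lemma adj_on_unitary:
  assumes S: "closed_csubspace S" and f: "unitary_on S f" and x: "x \<in> S"
  shows "f (adj_on S f x) = x"
proof -
  have cop: "cop_on S f" and iso: "\<And>y. y \<in> S \<Longrightarrow> norm (f y) = norm y" and "f ` S = S"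
    using f by (auto simp: unitary_on_def isometry_on_def)
  then obtain y where y: "y \<in> S" "x = f y" using x by blast
  have "inner (f a) x = inner a y" if "a \<in> S" for a
  proof -
    have "norm (f (a + y)) = norm (a + y)" using iso csubspace_add[OF closed_csubspaceD(1)[OF S]] that y by blast
    then show ?thesis
      unfolding y(2) cop_onD(2)[OF cop that y(1)] by (rule inner_eq_of_norm_eq[OF _ iso[OF that] iso[OF y(1)]])
  qed
  then have "adj_on S f x = y" using x y by (intro adj_on_eqI[OF S cop]) auto
  then show ?thesis using y by simp
qed

lemma orth_decomposition:
  assumes "closed_csubspace M"
  obtains p q where "p \<in> M" "q \<in> orth M" "x = p + q"
proof -
  obtain p where "p \<in> M" "\<forall>m\<in>M. inner (x - p) m = 0"
    using orthogonal_projection_exists assms by (metis closed_csubspace_def csubspace_def)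
  then show ?thesis using that[of p "x - p"] by (simp add: orth_def)
qed

text \<open>Fixes an intertwiner \<open>U\<close>, which \<open>std_irred_rep\<close> merely asserts
  to exist.\<close>

locale std_rep = dnc_tuple n z V for n z and V :: "nat \<Rightarrow> 'a::chilbert \<Rightarrow> 'a" +
  fixes A :: "nat set" and W :: "'w::chilbert set" and Ut :: "nat \<Rightarrow> 'w \<Rightarrow> 'w"
    and U :: "((nat \<Rightarrow> nat) \<Rightarrow> 'w) \<Rightarrow> 'a"
  assumes A: "A \<subseteq> {1..n}"
    and closed_W: "closed_csubspace W"
    and unitary_Ut: "\<And>j. j \<in> {1..n} - A \<Longrightarrow> unitary_on W (Ut j)"
    and bij_U: "bij_betw U (std_space A W) UNIV"
    and U_add: "\<And>f g. f \<in> std_space A W \<Longrightarrow> g \<in> std_space A W \<Longrightarrow> U (\<lambda>k. f k + g k) = U f + U g"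
    and U_scaleR: "\<And>r f. f \<in> std_space A W \<Longrightarrow> U (\<lambda>k. r *\<^sub>R f k) = r *\<^sub>R U f"
    and U_cJ: "\<And>f. f \<in> std_space A W \<Longrightarrow> U (\<lambda>k. cJ (f k)) = cJ (U f)"
    and norm_U: "\<And>f. f \<in> std_space A W \<Longrightarrow> norm (U f) = std_norm f"
    and U_std_op: "\<And>i f. i \<in> {1..n} \<Longrightarrow> f \<in> std_space A W \<Longrightarrow> U (std_op z A Ut i f) = V i (U f)"
    and irreducible_W: "irreducible_on W (insert id (Ut ` ({1..n} - A)))"

lemma std_irred_repE:
  assumes "dnc_tuple n z V" and "std_irred_rep n z V A W Ut"
  obtains U where "std_rep n z V A W Ut U"
proof -
  obtain U where "bij_betw U (std_space A W) UNIV \<and>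
        (\<forall>f\<in>std_space A W. \<forall>g\<in>std_space A W. U (\<lambda>k. f k + g k) = U f + U g) \<and>
        (\<forall>r. \<forall>f\<in>std_space A W. U (\<lambda>k. r *\<^sub>R f k) = r *\<^sub>R U f) \<and>
        (\<forall>f\<in>std_space A W. U (\<lambda>k. cJ (f k)) = cJ (U f)) \<and>
        (\<forall>f\<in>std_space A W. norm (U f) = std_norm f) \<and>
        (\<forall>i\<in>{1..n}. \<forall>f\<in>std_space A W. U (std_op z A Ut i f) = V i (U f))"
    using assms(2) unfolding std_irred_rep_def by blast
  then have "std_rep n z V A W Ut U"
    using assms unfolding std_rep_def std_rep_axioms_def std_irred_rep_def by simp
  then show ?thesis by (rule that)
qed

section \<open>Elementary tensors in a standard representation\<close>

context std_rep
begin

lemmas csubspace_W = closed_csubspaceD(1)[OF closed_W]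

abbreviation single_image :: "(nat \<Rightarrow> nat) \<Rightarrow> 'w \<Rightarrow> 'a" where
  "single_image k w \<equiv> U (single_at k w)"

lemma norm_U_sq:
  assumes "f \<in> std_space A W"
  shows "((\<lambda>k. (norm (f k))\<^sup>2) has_sum (norm (U f))\<^sup>2) UNIV"
proof -
  note sum = has_sum_infsum[OF std_spaceD(3)[OF assms]]
  have "(\<Sum>\<^sub>\<infinity>k. (norm (f k))\<^sup>2) \<ge> 0" by (rule infsum_nonneg) simp
  then show ?thesis using sum by (simp add: norm_U[OF assms] std_norm_def)
qed

text \<open>\<open>U\<close> is known only to be linear and norm-preserving. Adding an elementary
  tensor changes a single term of the norm series, by \<open>d\<close>, and polarization turns this
  into the inner product.\<close>

lemma inner_U_single:
  assumes f: "f \<in> std_space A W" and k: "k \<in> multi_indices A" and w: "w \<in> W"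
  shows "inner (U f) (single_image k w) = inner (f k) w"
proof -
  note s = single_at_mem[OF csubspace_W w k]
  define h where "h = (\<lambda>l. f l + single_at k w l)"
  define d where "d = (norm (f k + w))\<^sup>2 - (norm (f k))\<^sup>2"
  have "((\<lambda>l. (norm (f l))\<^sup>2 + single_at k d l) has_sum ((norm (U f))\<^sup>2 + d)) UNIV"
    using has_sum_add[OF norm_U_sq[OF f] has_sum_singleton[of k "single_at k d"]] by simp
  moreover have "(norm (f l))\<^sup>2 + single_at k d l = (norm (h l))\<^sup>2" for l
    by (cases "l = k") (simp_all add: h_def d_def)
  ultimately have sum: "((\<lambda>l. (norm (h l))\<^sup>2) has_sum ((norm (U f))\<^sup>2 + d)) UNIV" by simp
  have h: "h \<in> std_space A W"
  proof (rule std_spaceI)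
    show "h l \<in> W" for l
      using std_spaceD(1)[OF f] std_spaceD(1)[OF s] csubspace_W by (simp add: h_def csubspace_add)
    show "h l = 0" if "l \<notin> multi_indices A" for l
      using std_spaceD(2)[OF f that] std_spaceD(2)[OF s that] by (simp add: h_def)
    show "(\<lambda>l. (norm (h l))\<^sup>2) summable_on UNIV" using sum by (rule has_sum_imp_summable)
  qed
  have "(norm (U f + single_image k w))\<^sup>2 = (norm (U f))\<^sup>2 + d"
    using has_sum_unique[OF norm_U_sq[OF h] sum] U_add[OF f s] by (simp add: h_def)
  moreover have "(norm (single_image k w))\<^sup>2 = (norm w)\<^sup>2"
    using has_sum_unique[OF norm_U_sq[OF s] has_sum_norm_single_at] .
  ultimately show ?thesis
    by (simp add: d_def power2_norm_eq_inner inner_add_left inner_add_right inner_commute)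
qed

lemma norm_single_image: "k \<in> multi_indices A \<Longrightarrow> w \<in> W \<Longrightarrow> norm (single_image k w) = norm w"
  using inner_U_single[OF single_at_mem[OF csubspace_W]] by (simp add: norm_eq_sqrt_inner)

lemma single_image_add:
  assumes "k \<in> multi_indices A" "v \<in> W" "w \<in> W"
  shows "single_image k (v + w) = single_image k v + single_image k w"
proof -
  have "single_at k (v + w) = (\<lambda>l. single_at k v l + single_at k w l)"
    by (auto simp: single_at_def)
  then show ?thesis using assms by (simp add: U_add single_at_mem csubspace_W)
qed

lemma single_image_scaleR:
  assumes "k \<in> multi_indices A" "w \<in> W"
  shows "single_image k (r *\<^sub>R w) = r *\<^sub>R single_image k w"
proof -
  have "single_at k (r *\<^sub>R w) = (\<lambda>l. r *\<^sub>R single_at k w l)"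
    by (auto simp: single_at_def)
  then show ?thesis using assms by (simp add: U_scaleR single_at_mem csubspace_W)
qed

lemma single_image_cJ:
  assumes "k \<in> multi_indices A" "w \<in> W"
  shows "single_image k (cJ w) = cJ (single_image k w)"
proof -
  have "single_at k (cJ w) = (\<lambda>l. cJ (single_at k w l))"
    by (auto simp: single_at_def)
  then show ?thesis using assms by (simp add: U_cJ single_at_mem csubspace_W)
qed

lemma single_image_diff:
  assumes "k \<in> multi_indices A" "v \<in> W" "w \<in> W"
  shows "single_image k (v - w) = single_image k v - single_image k w"
  using single_image_add[OF assms(1), of "v - w" w] csubspace_diff[OF csubspace_W] assms by simp

text \<open>Totality of the elementary tensors: taking \<open>w\<close> to be the coefficient
  \<open>f k\<close> of \<open>x\<close> itself makes each coefficient vanish.\<close>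

lemma eq_zero_of_orthogonal_singles:
  assumes "\<And>k w. k \<in> multi_indices A \<Longrightarrow> w \<in> W \<Longrightarrow> inner x (single_image k w) = 0"
  shows "x = 0"
proof -
  obtain f where f: "f \<in> std_space A W" "x = U f"
    using bij_U by (metis UNIV_I bij_betw_def imageE)
  have "f k = 0" for k
  proof (cases "k \<in> multi_indices A")
    case True
    have "inner (f k) (f k) = 0"
      using assms[OF True] inner_U_single[OF f(1) True] std_spaceD(1)[OF f(1)] f(2) by simp
    then show ?thesis by simp
  next
    case False
    then show ?thesis using std_spaceD(2)[OF f(1)] by simp
  qed
  then have "(norm (U f))\<^sup>2 = 0" using has_sum_unique[OF norm_U_sq[OF f(1)], of 0] by simp
  then show ?thesis using f by simp
qed

lemma V_single_inside:
  assumes i: "i \<in> A" and k: "k \<in> multi_indices A" and w: "w \<in> W"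
  obtains c where "cmod c = 1" "\<And>w. w \<in> W \<Longrightarrow> V i (single_image k w) = single_image (k(i := Suc (k i))) (scaleC c w)"
proof
  let ?c = "\<Prod>i'\<in>{i'\<in>A. i' < i}. z i i' ^ k i'"
  have i': "i \<in> {1..n}" using i A by auto
  show "cmod ?c = 1" using A by (intro cmod_prod_z[OF i']) auto
  fix w assume w: "w \<in> W"
  have "std_op z A Ut i (single_at k w) = single_at (k(i := Suc (k i))) (scaleC ?c w)"
  proof
    fix l
    \<comment> \<open>Translates the lowering in the definition of \<open>std_op\<close> into a
      raising of \<open>k\<close>; the bound \<open>1 \<le> l i\<close> rules out truncated
      subtraction at 0.\<close>
    have "l = k(i := Suc (k i)) \<longleftrightarrow> 1 \<le> l i \<and> l(i := l i - 1) = k"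
    proof (intro iffI conjI)
      assume l: "1 \<le> l i \<and> l(i := l i - 1) = k"
      then have "k(i := Suc (k i)) = l(i := Suc (l i - 1))" by auto
      then show "l = k(i := Suc (k i))" using l by auto
    qed auto
    then show "std_op z A Ut i (single_at k w) l = single_at (k(i := Suc (k i))) (scaleC ?c w) l"
      using i by (auto simp: std_op_def single_at_def simp del: fun_upd_apply)
  qed
  then show "V i (single_image k w) = single_image (k(i := Suc (k i))) (scaleC ?c w)"
    using U_std_op[OF i' single_at_mem[OF csubspace_W w k]] by simp
qed

lemma V_single_outside:
  assumes j: "j \<in> {1..n} - A" and k: "k \<in> multi_indices A" and w: "w \<in> W"
  shows "V j (single_image k w) = single_image k (scaleC (\<Prod>i\<in>A. z j i ^ k i) (Ut j w))"
proof -
  have "cop_on W (Ut j)" using unitary_Ut[OF j] by (simp add: unitary_on_def isometry_on_def)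
  then have "Ut j 0 = 0" using cop_onD(3)[of W "Ut j" 0 0] csubspace_0[OF csubspace_W] by simp
  then have "std_op z A Ut j (single_at k w) = single_at k (scaleC (\<Prod>i\<in>A. z j i ^ k i) (Ut j w))"
    using j by (auto simp: std_op_def single_at_def)
  then show ?thesis
    using U_std_op[OF _ single_at_mem[OF csubspace_W w k], of j] j by simp
qed

lemma Ut_mem: "j \<in> {1..n} - A \<Longrightarrow> w \<in> W \<Longrightarrow> Ut j w \<in> W"
  using unitary_Ut unfolding unitary_on_def by blast

lemma adj_Ut_mem: "j \<in> {1..n} - A \<Longrightarrow> w \<in> W \<Longrightarrow> adj_on W (Ut j) w \<in> W"
  using unitary_Ut by (intro adj_on_mem closed_W) (auto simp: unitary_on_def isometry_on_def)

lemma Ut_adj_Ut: "j \<in> {1..n} - A \<Longrightarrow> w \<in> W \<Longrightarrow> Ut j (adj_on W (Ut j) w) = w"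
  using unitary_Ut by (intro adj_on_unitary closed_W)

text \<open>\<open>Ut j\<close> is onto \<open>W\<close>, so every elementary tensor lies in the
  range of \<open>V j\<close>; a vector killed by the adjoint is therefore orthogonal to a total
  set.\<close>

lemma surj_V:
  assumes j: "j \<in> {1..n} - A"
  shows "surj (V j)"
proof -
  have jn: "j \<in> {1..n}" using j by simp
  have inj: "x = 0" if x: "Vs j x = 0" for x
  proof (rule eq_zero_of_orthogonal_singles)
    fix k w assume k: "k \<in> multi_indices A" and w: "w \<in> W"
    let ?c = "\<Prod>i\<in>A. z j i ^ k i"
    \<comment> \<open>The preimage of the tensor with \<open>w\<close>: the scalar is undone, then
      \<open>Ut j\<close> is inverted by its adjoint.\<close>
    let ?v = "adj_on W (Ut j) (scaleC (cnj ?c) w)"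
    have w': "scaleC (cnj ?c) w \<in> W" using csubspace_scaleC[OF csubspace_W w] .
    have c: "cmod ?c = 1" using j A by (intro cmod_prod_z) auto
    have "V j (single_image k ?v) = single_image k (scaleC ?c (scaleC (cnj ?c) w))"
      using V_single_outside[OF j k adj_Ut_mem[OF j w']] Ut_adj_Ut[OF j w'] by (simp only:)
    also have "scaleC ?c (scaleC (cnj ?c) w) = w" using c by (rule scaleC_cnj_cancel)
    finally have "inner x (single_image k w) = inner x (V j (single_image k ?v))" by simp
    then show "inner x (single_image k w) = 0" using x by (simp add: inner_Vs'[OF jn])
  qed
  then show ?thesis by (rule surj_of_trivial_kernel[OF jn])
qed

lemma single_image_lower:
  assumes k: "k \<in> multi_indices A" and i: "i \<in> A" "k i \<noteq> 0" and w: "w \<in> W"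
  obtains v where "v \<in> W" "single_image k w = V i (single_image (k(i := k i - 1)) v)"
proof -
  let ?k = "k(i := k i - 1)"
  have k': "?k \<in> multi_indices A" using k by (auto simp: multi_indices_def)
  have eq: "?k(i := Suc (?k i)) = k" using i by auto
  obtain c where c: "cmod c = 1" "\<And>w. w \<in> W \<Longrightarrow> V i (single_image ?k w) = single_image k (scaleC c w)"
    using V_single_inside[OF i(1) k' w] unfolding eq by blast
  have "scaleC (cnj c) w \<in> W" using csubspace_scaleC[OF csubspace_W w] .
  moreover from this have "single_image k w = V i (single_image ?k (scaleC (cnj c) w))"
    using c by (simp only: scaleC_cnj_cancel)
  ultimately show ?thesis by (rule that)
qed

text \<open>A tensor with nonzero index lies in the range of some \<open>V i\<close> with
  \<open>i\<close> in \<open>A\<close>, so the corresponding coefficient of a vector of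
  \<open>ker A\<close> vanishes. Conversely such \<open>V i\<close> never produce index
  zero.\<close>

lemma ker_eq: "ker A = single_image zero_index ` W"
proof
  show "ker A \<subseteq> single_image zero_index ` W"
  proof
    fix x assume x: "x \<in> ker A"
    obtain f where f: "f \<in> std_space A W" "x = U f"
      using bij_U by (metis UNIV_I bij_betw_def imageE)
    have "f k = 0" if "k \<noteq> zero_index" for k
    proof (cases "k \<in> multi_indices A")
      case True
      obtain i where "k i \<noteq> 0" using \<open>k \<noteq> zero_index\<close> by (auto simp: fun_eq_iff)
      then have i: "i \<in> A" "k i \<noteq> 0" using True by (auto simp: multi_indices_def)
      have i': "i \<in> {1..n}" using A i(1) by blast
      obtain v where v: "single_image k (f k) = V i (single_image (k(i := k i - 1)) v)"
        using single_image_lower[OF True i std_spaceD(1)[OF f(1)]] by blast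
      have "inner (f k) (f k) = inner x (single_image k (f k))"
        using inner_U_single[OF f(1) True std_spaceD(1)[OF f(1)], of k] f(2) by simp
      then have "inner (f k) (f k) = inner (Vs i x) (single_image (k(i := k i - 1)) v)"
        by (simp only: v inner_Vs'[OF i'])
      then show ?thesis using kerD[OF x i(1)] by simp
    next
      case False
      then show ?thesis using std_spaceD(2)[OF f(1)] by simp
    qed
    then have "f l = single_at zero_index (f zero_index) l" for l
      by (cases "l = zero_index") simp_all
    then have "f = single_at zero_index (f zero_index)" by (rule ext)
    then show "x \<in> single_image zero_index ` W" using f std_spaceD(1)[OF f(1)] by (metis imageI)
  qed
  show "single_image zero_index ` W \<subseteq> ker A"
  proof
    fix x assume "x \<in> single_image zero_index ` W"
    then obtain w where w: "w \<in> W" and x: "x = single_image zero_index w" by blast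
    have "Vs i x = 0" if i: "i \<in> A" for i
    proof (rule eq_zero_of_orthogonal_singles)
      fix k v assume k: "k \<in> multi_indices A" and v: "v \<in> W"
      have i': "i \<in> {1..n}" using i A by auto
      let ?k = "k(i := Suc (k i))"
      obtain c where c: "V i (single_image k v) = single_image ?k (scaleC c v)"
        using V_single_inside[OF i k v] v by metis
      have "?k \<noteq> zero_index" by (metis fun_upd_same nat.distinct(1))
      moreover have "?k \<in> multi_indices A" using k i by (auto simp: multi_indices_def)
      ultimately have "inner x (V i (single_image k v)) = 0"
        using inner_U_single[OF single_at_mem[OF csubspace_W w zero_index_mem], of ?k "scaleC c v"] v csubspace_W
        by (simp add: c x csubspace_scaleC)
      then show "inner (Vs i x) (single_image k v) = 0" by (simp add: inner_Vs'[OF i'])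
    qed
    then show "x \<in> ker A" by (simp add: ker_def)
  qed
qed

section \<open>Reducing subspaces in a standard representation\<close>

lemma invariant_superset_ker:
  assumes M: "closed_csubspace M" and inv: "\<And>i x. i \<in> A \<Longrightarrow> x \<in> M \<Longrightarrow> V i x \<in> M"
    and ker: "ker A \<subseteq> M"
  shows "M = UNIV"
proof -
  have fin: "finite A" using A finite_subset by blast
  \<comment> \<open>Induction on the total degree: degree zero is \<open>ker A\<close>, and a tensor
    of positive degree is some \<open>V i\<close> applied to one of lower degree.\<close>
  have mem: "single_image k w \<in> M" if "k \<in> multi_indices A" "w \<in> W" "(\<Sum>i\<in>A. k i) = m" for k w m
    using that
  proof (induction m arbitrary: k w)
    case 0
    then have "k = zero_index" using fin by (auto simp: multi_indices_def fun_eq_iff)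
    then show ?case using ker ker_eq 0 by blast
  next
    case (Suc m)
    obtain i where i: "i \<in> A" "k i \<noteq> 0"
    proof -
      have "\<exists>i\<in>A. k i \<noteq> 0" using Suc.prems(3) by (metis nat.distinct(1) sum.neutral)
      then show ?thesis using that by blast
    qed
    let ?k = "k(i := k i - 1)"
    have "(\<Sum>j\<in>A. k j) = k i + (\<Sum>j\<in>A - {i}. k j)" using fin i(1) by (rule sum.remove)
    moreover have "(\<Sum>j\<in>A. ?k j) = ?k i + (\<Sum>j\<in>A - {i}. ?k j)" using fin i(1) by (rule sum.remove)
    moreover have "(\<Sum>j\<in>A - {i}. ?k j) = (\<Sum>j\<in>A - {i}. k j)" by (intro sum.cong) auto
    ultimately have "(\<Sum>j\<in>A. ?k j) = m" using Suc.prems(3) i by simp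
    moreover have "?k \<in> multi_indices A" using Suc.prems(1) by (auto simp: multi_indices_def)
    moreover obtain v where "v \<in> W" "single_image k w = V i (single_image ?k v)"
      using single_image_lower[OF Suc.prems(1) i Suc.prems(2)] by blast
    ultimately show ?case using Suc.IH inv[OF i(1)] by metis
  qed
  have "y = 0" if "y \<in> orth M" for y
    using that mem by (intro eq_zero_of_orthogonal_singles) (auto simp: orth_def)
  then have "x \<in> M" for x
    by (intro mem_of_orthogonal_orth[OF closed_csubspace_UNIV M]) force+
  then show ?thesis by blast
qed

text \<open>Otherwise the zero subspace would be invariant and contain \<open>ker A\<close>, hence
  be the whole space.\<close>

lemma ker_nontrivial: "(UNIV :: 'a set) \<noteq> {0} \<Longrightarrow> ker A \<noteq> {0}"
proof
  assume "(UNIV :: 'a set) \<noteq> {0}" "ker A = {0}"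
  moreover have "closed_csubspace ({0} :: 'a set)"
    by (auto simp: closed_csubspace_def csubspace_def subspace_def)
  moreover have "V i x \<in> {0}" if "i \<in> A" "x \<in> {0}" for i x
  proof -
    have "i \<in> {1..n}" using that A by blast
    then show ?thesis using that V_zero by simp
  qed
  ultimately show False using invariant_superset_ker[of "{0}"] by blast
qed

lemma not_surj_V:
  assumes ne: "(UNIV :: 'a set) \<noteq> {0}" and i: "i \<in> A"
  shows "\<not> surj (V i)"
proof
  assume surj: "surj (V i)"
  have i': "i \<in> {1..n}" using i A by auto
  have "x = 0" if "x \<in> ker A" for x
  proof -
    have "V i (Vs i x) = x" by (rule V_Vs[OF i' surj])
    then show ?thesis using kerD[OF that i] V_zero[OF i'] by simp
  qed
  then show False using ker_nontrivial[OF ne] csubspace_0[OF closed_csubspaceD(1)[OF closed_csubspace_ker[OF A]]] by blast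
qed

text \<open>The pullback of \<open>M\<close> to \<open>W\<close> along the isometry
  \<open>\<iota>\<close> is closed and reduces the wandering data, so irreducibility of
  \<open>W\<close> leaves two cases.\<close>

lemma ker_disjoint_or_subset:
  assumes M: "closed_csubspace M"
    and inv: "\<And>i x. i \<in> {1..n} \<Longrightarrow> x \<in> M \<Longrightarrow> V i x \<in> M" "\<And>i x. i \<in> {1..n} \<Longrightarrow> x \<in> M \<Longrightarrow> Vs i x \<in> M"
  shows "ker A \<inter> M \<subseteq> {0} \<or> ker A \<subseteq> M"
proof -
  define \<iota> where "\<iota> = single_image zero_index"
  define L where "L = {w \<in> W. \<iota> w \<in> M}"
  note cM = closed_csubspaceD(1)[OF M]
  have \<iota>_V: "V j (\<iota> w) = \<iota> (Ut j w)" if "j \<in> {1..n} - A" "w \<in> W" for j w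
    using V_single_outside[OF that(1) zero_index_mem that(2)] by (simp add: \<iota>_def)
  have \<iota>0: "\<iota> 0 = 0"
    using norm_single_image[OF zero_index_mem csubspace_0[OF csubspace_W]] by (simp add: \<iota>_def)
  have "csubspace L"
    unfolding csubspace_def subspace_def L_def \<iota>_def
    using csubspace_W cM \<iota>0 by (auto simp: csubspace_closure single_image_add single_image_scaleR single_image_cJ \<iota>_def)
  moreover have "closed L"
  proof (rule closed_sequential_limits[THEN iffD2], intro allI impI)
    fix s l assume s: "(\<forall>n. s n \<in> L) \<and> s \<longlonglongrightarrow> l"
    then have l: "l \<in> W"
      using closed_sequentially[OF closed_csubspaceD(2)[OF closed_W], of s l] by (simp add: L_def)
    have "norm (\<iota> (s m) - \<iota> l) = norm (s m - l)" for m
      using s l norm_single_image[OF zero_index_mem, of "s m - l"] csubspace_diff[OF csubspace_W]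
      by (simp add: L_def \<iota>_def single_image_diff)
    moreover have "(\<lambda>m. norm (s m - l)) \<longlonglongrightarrow> 0"
      using s by (simp add: tendsto_norm_zero_iff LIM_zero_iff)
    ultimately have "(\<lambda>m. \<iota> (s m)) \<longlonglongrightarrow> \<iota> l"
      using tendsto_norm_zero_iff[of "\<lambda>m. \<iota> (s m) - \<iota> l"] by (simp add: LIM_zero_iff)
    then have "\<iota> l \<in> M"
      using closed_sequentially[OF closed_csubspaceD(2)[OF M], of "\<lambda>m. \<iota> (s m)" "\<iota> l"] s by (simp add: L_def)
    then show "l \<in> L" using l by (simp add: L_def)
  qed
  ultimately have L: "closed_csubspace L" by (simp add: closed_csubspace_def)
  have inv_L: "g w \<in> L \<and> adj_on W g w \<in> L" if g: "g \<in> insert id (Ut ` ({1..n} - A))" and w: "w \<in> L" for g w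
  proof (cases "g = id")
    case True
    have "w \<in> W" using w by (simp add: L_def)
    then have "adj_on W id w = w" by (intro adj_on_eqI closed_W cop_on_id) auto
    then show ?thesis using True w by simp
  next
    case False
    then obtain j where j: "j \<in> {1..n} - A" "g = Ut j" using g by blast
    have jn: "j \<in> {1..n}" using j by simp
    have w': "w \<in> W" "\<iota> w \<in> M" using w by (auto simp: L_def)
    \<comment> \<open>The adjoint of \<open>Ut j\<close> is transported as an inverse: applying
      \<open>Vs j\<close> to both sides yields the intertwining relation for adjoints.\<close>
    have "V j (\<iota> (adj_on W (Ut j) w)) = \<iota> w"
      using \<iota>_V[OF j(1) adj_Ut_mem[OF j(1) w'(1)]] Ut_adj_Ut[OF j(1) w'(1)] by simp
    then have "\<iota> (adj_on W (Ut j) w) = Vs j (\<iota> w)" using Vs_V[OF jn] by metis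
    then show ?thesis
      using w' inv[OF jn] \<iota>_V[OF j(1) w'(1)] Ut_mem[OF j(1) w'(1)] adj_Ut_mem[OF j(1) w'(1)] j(2)
      by (simp add: L_def) metis
  qed
  have cop: "cop_on W g" if "g \<in> insert id (Ut ` ({1..n} - A))" for g
    using that unitary_Ut cop_on_id by (auto simp: unitary_on_def isometry_on_def)
  have "L \<subseteq> W" by (auto simp: L_def)
  then have "L = {0} \<or> L = W"
    using iffD1[OF irreducible_on_iff[OF closed_W cop] irreducible_W] L inv_L by blast
  moreover have ker: "ker A = \<iota> ` W" using ker_eq by (simp only: \<iota>_def)
  ultimately show ?thesis
  proof (elim disjE)
    assume L0: "L = {0}"
    have "x = 0" if x: "x \<in> ker A" "x \<in> M" for x
    proof -
      obtain w where w: "w \<in> W" "x = \<iota> w" using x(1) ker by blast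
      then have "w \<in> L" using x(2) by (simp add: L_def)
      then show ?thesis using L0 w(2) \<iota>0 by simp
    qed
    then show ?thesis by blast
  next
    assume "L = W"
    then show ?thesis using ker by (auto simp: L_def)
  qed
qed

text \<open>If \<open>M\<close> meets \<open>ker A\<close> trivially, its complement contains
  \<open>ker A\<close>: the adjoints respect the splitting into \<open>M\<close> and its complement,
  so the \<open>M\<close>-component \<open>p\<close> of a vector of \<open>ker A\<close> is again in
  \<open>ker A\<close>, hence zero. The complement is then everything.\<close>

lemma irreducible: "irreducible_on UNIV (V ` {1..n})"
  unfolding irreducible_iff
proof (intro allI impI)
  fix M assume M: "closed_csubspace M"
    and inv: "\<forall>i\<in>{1..n}. \<forall>x\<in>M. V i x \<in> M \<and> Vs i x \<in> M"
  note cM = closed_csubspaceD(1)[OF M]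
  have "closed_csubspace (orth M)"
    using csubspace_cJ[OF cM] by (rule closed_csubspace_orth)
  have inv_orth: "V i y \<in> orth M" "Vs i y \<in> orth M" if "i \<in> {1..n}" "y \<in> orth M" for i y
    using that inv by (auto simp: orth_def inner_Vs simp flip: inner_Vs')
  have "ker A \<inter> M \<subseteq> {0} \<or> ker A \<subseteq> M"
    using inv by (intro ker_disjoint_or_subset[OF M]) auto
  then show "M = {0} \<or> M = UNIV"
  proof
    assume "ker A \<subseteq> M"
    then have "M = UNIV" using inv A by (intro invariant_superset_ker[OF M]) auto
    then show ?thesis ..
  next
    assume triv: "ker A \<inter> M \<subseteq> {0}"
    have "x \<in> orth M" if x: "x \<in> ker A" for x
    proof -
      obtain p q where pq: "p \<in> M" "q \<in> orth M" "x = p + q" using orth_decomposition[OF M] by metis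
      have "Vs i p = 0" if i: "i \<in> A" for i
      proof -
        have i': "i \<in> {1..n}" using i A by auto
        have "Vs i p + Vs i q = 0"
          using kerD[OF x i] cop_onD(2)[OF Vs_cop[OF i']] pq(3) by simp
        moreover have "inner (Vs i q) (Vs i p) = 0"
          using inv_orth(2)[OF i' pq(2)] inv i' pq(1) by (simp add: orth_def)
        ultimately have "inner (Vs i p) (Vs i p) = 0"
          by (metis add_eq_0_iff inner_minus_left minus_equation_iff neg_equal_0_iff_equal)
        then show ?thesis by simp
      qed
      then have "p \<in> ker A" by (simp add: ker_def)
      then have "p = 0" using triv pq(1) by blast
      then show ?thesis using pq by simp
    qed
    then have "orth M = UNIV"
      using inv_orth(1) A by (intro invariant_superset_ker[OF \<open>closed_csubspace (orth M)\<close>]) auto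
    then have "inner m m = 0" if "m \<in> M" for m
      using that unfolding orth_def by blast
    then have "M = {0}" using csubspace_0[OF cM] by auto
    then show ?thesis ..
  qed
qed

end

subsection \<open>Unitary equivalence\<close>

text \<open>A common membership test for families changed pointwise by scalars, by \<open>cJ\<close>
  or by an isometry between wandering subspaces.\<close>

lemma std_space_dominated:
  assumes f: "f \<in> std_space A W" and g: "\<And>k. g k \<in> W'" and le: "\<And>k. norm (g k) \<le> C * norm (f k)"
  shows "g \<in> std_space A W'"
proof (rule std_spaceI[OF g])
  show "g k = 0" if "k \<notin> multi_indices A" for k
    using le[of k] std_spaceD(2)[OF f that] by simp
  have "(\<lambda>k. C\<^sup>2 * (norm (f k))\<^sup>2) summable_on UNIV"
    using std_spaceD(3)[OF f] by (rule summable_on_cmult_right)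
  then show "(\<lambda>k. (norm (g k))\<^sup>2) summable_on UNIV"
  proof (rule summable_on_comparison_test)
    show "(norm (g k))\<^sup>2 \<le> C\<^sup>2 * (norm (f k))\<^sup>2" for k
      using power_mono[OF le[of k], of 2] by (simp add: power_mult_distrib)
  qed simp
qed

lemma std_space_add:
  assumes W: "csubspace W" and f: "f \<in> std_space A W" and g: "g \<in> std_space A W"
  shows "(\<lambda>k. f k + g k) \<in> std_space A W"
proof (rule std_spaceI)
  show "f k + g k \<in> W" for k using csubspace_add[OF W] std_spaceD(1) f g by blast
  show "f k + g k = 0" if "k \<notin> multi_indices A" for k
    using std_spaceD(2)[OF f that] std_spaceD(2)[OF g that] by simp
  have "(\<lambda>k. 2 * (norm (f k))\<^sup>2 + 2 * (norm (g k))\<^sup>2) summable_on UNIV"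
    using std_spaceD(3)[OF f] std_spaceD(3)[OF g] by (intro summable_on_add summable_on_cmult_right)
  then show "(\<lambda>k. (norm (f k + g k))\<^sup>2) summable_on UNIV"
  proof (rule summable_on_comparison_test)
    fix k
    \<comment> \<open>The parallelogram law supplies the summable majorant.\<close>
    have "(norm (f k + g k))\<^sup>2 + (norm (f k - g k))\<^sup>2 = 2 * (norm (f k))\<^sup>2 + 2 * (norm (g k))\<^sup>2"
      by (simp add: power2_norm_eq_inner algebra_simps inner_commute)
    then show "(norm (f k + g k))\<^sup>2 \<le> 2 * (norm (f k))\<^sup>2 + 2 * (norm (g k))\<^sup>2"
      by (smt (verit) zero_le_power2)
  qed simp
qed

section \<open>Wandering subspaces and transport of equivalences\<close>

context dnc_tuple
begin

text \<open>Needed to evaluate, on a family already transformed by \<open>std_op\<close>, an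
  intertwiner known only on \<open>std_space\<close>.\<close>

lemma std_op_mem:
  assumes A: "A \<subseteq> {1..n}" and f: "f \<in> std_space A (ker A)" and i: "i \<in> {1..n}"
  shows "std_op z A V i f \<in> std_space A (ker A)"
proof -
  note csub = closed_csubspaceD(1)[OF closed_csubspace_ker[OF A]]
  show ?thesis
  proof (cases "i \<in> A")
    case True
    let ?h = "\<lambda>k. k(i := Suc (k i))"
    let ?c = "\<lambda>k. \<Prod>i'\<in>{i'\<in>A. i' < i}. z i i' ^ k i'"
    have c: "cmod (?c k) = 1" for k using A by (intro cmod_prod_z[OF i]) auto
    note h = std_op_increment[OF True, of z V f] and out = std_op_not_increment[OF True, of _ z V f]
    show ?thesis
    proof (rule std_spaceI)
      show "std_op z A V i f k \<in> ker A" for k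
        using h out std_spaceD(1)[OF f] csub by (cases "k \<in> range ?h") (auto simp: csubspace_closure)
      show "std_op z A V i f k = 0" if k: "k \<notin> multi_indices A" for k
      proof (cases "k \<in> range ?h")
        case True
        then obtain l where l: "k = ?h l" by blast
        then have "l \<notin> multi_indices A" using k \<open>i \<in> A\<close> by (auto simp: multi_indices_def split: if_splits)
        then show ?thesis unfolding l h using std_spaceD(2)[OF f] by simp
      qed (rule out)
      have "((\<lambda>k. (norm (std_op z A V i f k))\<^sup>2) \<circ> ?h) summable_on UNIV"
        using std_spaceD(3)[OF f] by (simp only: o_def h norm_scaleC c mult_1)
      then have "(\<lambda>k. (norm (std_op z A V i f k))\<^sup>2) summable_on range ?h"
        by (simp only: summable_on_reindex[OF inj_increment])
      then show "(\<lambda>k. (norm (std_op z A V i f k))\<^sup>2) summable_on UNIV"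
        using out by (subst summable_on_cong_neutral[where S = UNIV and T = "range ?h"]) auto
    qed
  next
    case False
    have "cmod (\<Prod>i'\<in>A. z i i' ^ k i') = 1" for k
      using A False by (intro cmod_prod_z[OF i]) auto
    then show ?thesis
      using False i std_spaceD(1)[OF f] ker_reducing(1)[OF A] csub
      by (intro std_space_dominated[OF f, where C=1]) (auto simp: std_op_def norm_V csubspace_scaleC)
  qed
qed

text \<open>A surjective \<open>V j\<close> is inverted by its adjoint, which preserves
  \<open>ker A\<close>; so \<open>V j\<close> maps \<open>ker A\<close> onto itself and all the sets
  intersected in \<open>wandering_subspace\<close> equal \<open>ker A\<close>.\<close>

lemma wandering_subspace_eq_ker:
  assumes A: "A \<subseteq> {1..n}" and surj: "\<And>j. j \<in> {1..n} - A \<Longrightarrow> surj (V j)"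
  shows "wandering_subspace n V A = ker A"
proof -
  have V_ker: "V j ` ker A = ker A" if j: "j \<in> {1..n} - A" for j
  proof
    show "V j ` ker A \<subseteq> ker A" using ker_reducing(1)[OF A j] by blast
    show "ker A \<subseteq> V j ` ker A"
    proof
      fix x assume "x \<in> ker A"
      moreover have "V j (Vs j x) = x" using V_Vs[OF _ surj[OF j]] j by simp
      ultimately show "x \<in> V j ` ker A" using ker_reducing(2)[OF A j] by (metis imageI)
    qed
  qed
  have pow: "(V j ^^ e) ` ker A = ker A" if j: "j \<in> {1..n} - A" for j e
  proof (induction e)
    case (Suc e)
    have "(V j ^^ Suc e) ` ker A = V j ` ((V j ^^ e) ` ker A)" by (simp add: image_comp)
    then show ?case using Suc V_ker[OF j] by simp
  qed simp
  have "foldr (\<lambda>j f. (V j ^^ m j) \<circ> f) js id ` ker A = ker A" if "set js \<subseteq> {1..n} - A" for js m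
    using that
  proof (induction js)
    case (Cons j js)
    have IH: "foldr (\<lambda>j f. (V j ^^ m j) \<circ> f) js id ` ker A = ker A"
      using Cons.prems by (intro Cons.IH) auto
    have "foldr (\<lambda>j f. (V j ^^ m j) \<circ> f) (j # js) id ` ker A
        = (V j ^^ m j) ` (foldr (\<lambda>j f. (V j ^^ m j) \<circ> f) js id ` ker A)"
      by (simp add: image_comp)
    then show ?case unfolding IH using pow[of j "m j"] Cons.prems by (simp only: list.set insert_subset)
  qed simp
  moreover have "set [j \<leftarrow> [1..<Suc n]. j \<notin> A] \<subseteq> {1..n} - A" by auto
  ultimately have "foldr (\<lambda>j f. (V j ^^ m j) \<circ> f) [j \<leftarrow> [1..<Suc n]. j \<notin> A] id ` ker A = ker A" for m
    by blast
  then show ?thesis unfolding wandering_subspace_def ker_def[symmetric] by simp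
qed

end

text \<open>The equivalence is onto and preserves inner products, so it intertwines the adjoints as
  well. It therefore carries one joint kernel onto the other and can be restricted.\<close>

lemma tuple_ueq_imp_data_ueq:
  assumes V: "dnc_tuple n z V" and V': "dnc_tuple n z V'"
    and A: "A \<subseteq> {1..n}" and surj: "\<And>j. j \<in> {1..n} - A \<Longrightarrow> surj (V j)"
      "\<And>j. j \<in> {1..n} - A \<Longrightarrow> surj (V' j)"
    and ueq: "tuple_ueq n V V'"
  shows "wandering_data_ueq n A V V'"
proof -
  interpret D: dnc_tuple n z V by fact
  interpret E: dnc_tuple n z V' by fact
  have wD: "wandering_subspace n V A = D.ker A"
    by (rule D.wandering_subspace_eq_ker[OF A]) (rule surj(1))
  have wE: "wandering_subspace n V' A = E.ker A"
    by (rule E.wandering_subspace_eq_ker[OF A]) (rule surj(2))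
  obtain U where bij: "bij U" and add: "\<And>x y. U (x + y) = U x + U y"
    and scale: "\<And>r x. U (r *\<^sub>R x) = r *\<^sub>R U x" and cJ: "\<And>x. U (cJ x) = cJ (U x)"
    and norm: "\<And>x. norm (U x) = norm x" and UV: "\<And>i x. i \<in> {1..n} \<Longrightarrow> U (V i x) = V' i (U x)"
    using ueq unfolding tuple_ueq_def by blast
  have inner: "inner (U x) (U y) = inner x y" for x y
    using norm[of "x + y"] unfolding add by (rule inner_eq_of_norm_eq[OF _ norm norm])
  have Vs: "E.Vs i (U x) = U (D.Vs i x)" if i: "i \<in> {1..n}" for i x
  proof (rule adj_on_eqI[OF closed_csubspace_UNIV E.V_cop[OF i]])
    fix y
    obtain u where u: "y = U u" using bij by (metis bij_pointE)
    show "inner (V' i y) (U x) = inner y (U (D.Vs i x))"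
      by (simp add: u inner UV[OF i, symmetric] D.inner_Vs[OF i])
  qed auto
  have "U 0 = 0" using add[of 0 0] by simp
  then have U0: "U x = 0 \<longleftrightarrow> x = 0" for x using bij by (metis bij_def inj_eq)
  have "U ` D.ker A = E.ker A"
  proof
    show "U ` D.ker A \<subseteq> E.ker A"
      using A by (auto simp: D.ker_def E.ker_def Vs U0 subset_iff)
    show "E.ker A \<subseteq> U ` D.ker A"
    proof
      fix y assume y: "y \<in> E.ker A"
      obtain u where u: "y = U u" using bij by (metis bij_pointE)
      have "u \<in> D.ker A" using y A by (auto simp: D.ker_def E.ker_def Vs U0 u subset_iff)
      then show "y \<in> U ` D.ker A" using u by blast
    qed
  qed
  then have "bij_betw U (D.ker A) (E.ker A)"
    using bij by (metis bij_betw_subset subset_UNIV)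
  then show ?thesis
    unfolding wandering_data_ueq_def wD wE Let_def
    using add scale cJ norm UV by (intro exI[of _ U]) auto
qed

text \<open>Both tuples are modelled on their joint kernels. \<open>T\<close> passes to the model of
  \<open>V\<close>, applies \<open>u\<close> to each coefficient, and returns through the model of
  \<open>V'\<close>.\<close>

lemma data_ueq_imp_tuple_ueq:
  assumes V: "dnc_tuple n z V" and V': "dnc_tuple n z V'"
    and irr: "irreducible_on UNIV (V ` {1..n})" "irreducible_on UNIV (V' ` {1..n})"
    and A: "A \<subseteq> {1..n}" and surj: "\<And>j. j \<in> {1..n} - A \<Longrightarrow> surj (V j)"
      "\<And>j. j \<in> {1..n} - A \<Longrightarrow> surj (V' j)"
    and ne: "dnc_tuple.ker V A \<noteq> {0}" "dnc_tuple.ker V' A \<noteq> {0}"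
    and ueq: "wandering_data_ueq n A V V'"
  shows "tuple_ueq n V V'"
proof -
  interpret D: dnc_tuple n z V by fact
  interpret E: dnc_tuple n z V' by fact
  have wD: "wandering_subspace n V A = D.ker A"
    by (rule D.wandering_subspace_eq_ker[OF A]) (rule surj(1))
  have wE: "wandering_subspace n V' A = E.ker A"
    by (rule E.wandering_subspace_eq_ker[OF A]) (rule surj(2))
  let ?S = "std_space A (D.ker A)" and ?S' = "std_space A (E.ker A)"
  note csub = closed_csubspaceD(1)[OF D.closed_csubspace_ker[OF A]]
  obtain u where bij_u: "bij_betw u (D.ker A) (E.ker A)"
    and add: "\<And>x y. x \<in> D.ker A \<Longrightarrow> y \<in> D.ker A \<Longrightarrow> u (x + y) = u x + u y"
    and scale: "\<And>r x. x \<in> D.ker A \<Longrightarrow> u (r *\<^sub>R x) = r *\<^sub>R u x"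
    and cJ: "\<And>x. x \<in> D.ker A \<Longrightarrow> u (cJ x) = cJ (u x)"
    and norm: "\<And>x. x \<in> D.ker A \<Longrightarrow> norm (u x) = norm x"
    and uV: "\<And>j x. j \<in> {1..n} - A \<Longrightarrow> x \<in> D.ker A \<Longrightarrow> u (V j x) = V' j (u x)"
    using ueq unfolding wandering_data_ueq_def wD wE Let_def by blast
  have u_mem: "u x \<in> E.ker A" if "x \<in> D.ker A" for x
    using bij_u that by (auto simp: bij_betw_def)
  have u0: "u 0 = 0" using scale[OF csubspace_0[OF csub], of 0] by simp
  have u_scaleC: "u (scaleC c x) = scaleC c (u x)" if "x \<in> D.ker A" for c x
    using that csub by (simp add: scaleC_def add scale cJ csubspace_closure)
  have bij_D: "bij_betw D.std_sum ?S UNIV"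
    by (rule D.std_irred_rep_ker(1)[OF irr(1) A]) (use surj(1) ne(1) in auto)
  have bij_E: "bij_betw E.std_sum ?S' UNIV"
    by (rule E.std_irred_rep_ker(1)[OF irr(2) A]) (use surj(2) ne(2) in auto)
  have comp_mem: "(\<lambda>k. u (f k)) \<in> ?S'" if "f \<in> ?S" for f
    using that std_spaceD(1)[OF that] by (intro std_space_dominated[OF that, where C=1]) (auto simp: u_mem norm)
  define T where "T x = E.std_sum (\<lambda>k. u (inv_into ?S D.std_sum x k))" for x
  have T: "T (D.std_sum f) = E.std_sum (\<lambda>k. u (f k))" if "f \<in> ?S" for f
    using that bij_D by (simp add: T_def bij_betw_inv_into_left)
  have rep: "\<exists>f\<in>?S. x = D.std_sum f" for x
    using bij_D by (metis UNIV_I bij_betw_def imageE)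
  have T_norm: "norm (T x) = norm x" for x
  proof -
    obtain f where f: "f \<in> ?S" "x = D.std_sum f" using rep by blast
    then show ?thesis
      using D.norm_std_sum[OF A f(1)] E.norm_std_sum[OF A comp_mem[OF f(1)]] std_spaceD(1)[OF f(1)]
      by (simp add: T std_norm_def norm)
  qed
  have T_add: "T (x + y) = T x + T y" for x y
  proof -
    obtain f g where f: "f \<in> ?S" "x = D.std_sum f" and g: "g \<in> ?S" "y = D.std_sum g" using rep by metis
    have "x + y = D.std_sum (\<lambda>k. f k + g k)" using D.std_sum_add[OF A f(1) g(1)] f g by simp
    then show ?thesis
      using T[OF std_space_add[OF csub f(1) g(1)]] T[OF f(1)] T[OF g(1)] f(2) g(2)
        E.std_sum_add[OF A comp_mem[OF f(1)] comp_mem[OF g(1)]] std_spaceD(1)[OF f(1)] std_spaceD(1)[OF g(1)]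
      by (simp add: add)
  qed
  have T_scale: "T (r *\<^sub>R x) = r *\<^sub>R T x" for r x
  proof -
    obtain f where f: "f \<in> ?S" "x = D.std_sum f" using rep by blast
    have mem: "(\<lambda>k. r *\<^sub>R f k) \<in> ?S"
      using std_spaceD(1)[OF f(1)] csub by (intro std_space_dominated[OF f(1), where C="\<bar>r\<bar>"]) (auto simp: csubspace_closure)
    show ?thesis
      using T[OF mem] T[OF f(1)] D.std_sum_scaleR[OF A f(1)] E.std_sum_scaleR[OF A comp_mem[OF f(1)]] std_spaceD(1)[OF f(1)] f(2)
      by (simp add: scale)
  qed
  have T_cJ: "T (cJ x) = cJ (T x)" for x
  proof -
    obtain f where f: "f \<in> ?S" "x = D.std_sum f" using rep by blast
    have mem: "(\<lambda>k. cJ (f k)) \<in> ?S"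
      using std_spaceD(1)[OF f(1)] csub by (intro std_space_dominated[OF f(1), where C=1]) (auto simp: csubspace_closure)
    show ?thesis
      using T[OF mem] T[OF f(1)] D.std_sum_cJ[OF A f(1)] E.std_sum_cJ[OF A comp_mem[OF f(1)]] std_spaceD(1)[OF f(1)] f(2)
      by (simp add: cJ)
  qed
  have T_V: "T (V i x) = V' i (T x)" if i: "i \<in> {1..n}" for i x
  proof -
    obtain f where f: "f \<in> ?S" "x = D.std_sum f" using rep by blast
    have f_ker: "f k \<in> D.ker A" for k using std_spaceD(1)[OF f(1)] .
    \<comment> \<open>The model operators shift indices, multiply by scalars, and apply
      \<open>V i\<close> for \<open>i\<close> outside \<open>A\<close>; \<open>u\<close> is
      compatible with all three.\<close>
    have "(\<lambda>k. u (std_op z A V i f k)) = std_op z A V' i (\<lambda>k. u (f k))"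
    proof (cases "i \<in> A")
      case True
      then show ?thesis by (auto simp: std_op_def fun_eq_iff u_scaleC[OF f_ker] u0)
    next
      case False
      then have "V i (f k) \<in> D.ker A" for k using D.ker_reducing(1)[OF A _ f_ker] i by blast
      then show ?thesis using False i uV[OF _ f_ker] by (simp add: std_op_def fun_eq_iff u_scaleC)
    qed
    then show ?thesis
      using T[OF D.std_op_mem[OF A f(1) i]] T[OF f(1)] D.std_sum_std_op[OF A f(1) i]
        E.std_sum_std_op[OF A comp_mem[OF f(1)] i] f(2) by simp
  qed
  have "inj T"
  proof (rule injI)
    fix x y assume "T x = T y"
    moreover have "T x = T (x - y) + T y" using T_add[of "x - y" y] by simp
    ultimately show "x = y" using T_norm[of "x - y"] by simp
  qed
  moreover have "\<exists>x. y = T x" for y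
  proof -
    obtain g where g: "g \<in> ?S'" "y = E.std_sum g" using bij_E by (metis UNIV_I bij_betw_def imageE)
    define f where "f k = inv_into (D.ker A) u (g k)" for k
    have f: "f k \<in> D.ker A" "u (f k) = g k" for k
      using bij_u std_spaceD(1)[OF g(1), of k] unfolding f_def
      by (auto simp: bij_betw_def inv_into_into f_inv_into_f)
    have "f \<in> ?S"
      using f norm[OF f(1)] by (intro std_space_dominated[OF g(1), where C=1]) auto
    then have "T (D.std_sum f) = y" using T g(2) f(2) by simp
    then show ?thesis by blast
  qed
  ultimately have "bij T" by (auto simp: bij_def surj_def)
  then show ?thesis
    unfolding tuple_ueq_def using T_add T_scale T_cJ T_norm T_V by (intro exI[of _ T]) auto
qed

text \<open>An equivalence carries the range of \<open>V i\<close> onto that of \<open>V' i\<close>.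
  This makes the index set a unitary invariant.\<close>

lemma tuple_ueq_surj_iff:
  assumes "tuple_ueq n V V'" "i \<in> {1..n}"
  shows "surj (V i) \<longleftrightarrow> surj (V' i)"
proof -
  obtain U where bij: "bij U" and UV: "\<And>x. U (V i x) = V' i (U x)"
    using assms unfolding tuple_ueq_def by blast
  have "V' i \<circ> U = U \<circ> V i" using UV by (simp add: fun_eq_iff)
  then have "range (V' i) = U ` range (V i)"
    using bij by (metis bij_is_surj image_comp)
  then show ?thesis using bij by (metis bij_is_inj bij_is_surj inj_image_eq_iff)
qed

text \<open>An existential cannot range over types: the forward direction finds \<open>W\<close>
  inside the given space, namely as some \<open>ker A\<close>, while the converse holds for
  \<open>W\<close> in an arbitrary type. In the equivalence part the representations determine
  \<open>A\<close> and \<open>A'\<close>; the data compared are those of \<open>V\<close> and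
  \<open>V'\<close> themselves.\<close>

theorem theorem5p4:
  fixes n :: nat and z :: "nat \<Rightarrow> nat \<Rightarrow> complex"
    and V :: "nat \<Rightarrow> 'a::chilbert \<Rightarrow> 'a"
  assumes n: "n \<ge> 1"
    and z_T: "\<forall>i\<in>{1..n}. \<forall>j\<in>{1..n}. i \<noteq> j \<longrightarrow> norm (z i j) = 1"
    and z_sym: "\<forall>i\<in>{1..n}. \<forall>j\<in>{1..n}. i \<noteq> j \<longrightarrow> z j i = cnj (z i j)"
    and V: "dnc_isometries n z V"
  shows
    "(irreducible_on UNIV (V ` {1..n}) \<longrightarrow>
        (\<exists>A (W::'a set) Ut. std_irred_rep n z V A W Ut))
     \<and> ((\<exists>A (W::'w::chilbert set) Ut. std_irred_rep n z V A W Ut) \<longrightarrow>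
        irreducible_on UNIV (V ` {1..n}))
     \<and> (\<forall>(V'::nat \<Rightarrow> 'b::chilbert \<Rightarrow> 'b) A (W::'w set) Ut A' (W'::'w2::chilbert set) Ut'.
          dnc_isometries n z V' \<and> (UNIV::'a set) \<noteq> {0} \<and> (UNIV::'b set) \<noteq> {0} \<and>
          irreducible_on UNIV (V ` {1..n}) \<and> irreducible_on UNIV (V' ` {1..n}) \<and>
          std_irred_rep n z V A W Ut \<and> std_irred_rep n z V' A' W' Ut' \<longrightarrow>
          (tuple_ueq n V V' \<longleftrightarrow> A = A' \<and> wandering_data_ueq n A V V'))"
proof (intro conjI impI allI)
  have D: "dnc_tuple n z V" using z_T V by (simp add: dnc_tuple_def)
  interpret D: dnc_tuple n z V by (rule D)
  show "\<exists>A (W::'a set) Ut. std_irred_rep n z V A W Ut" if irr: "irreducible_on UNIV (V ` {1..n})"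
  proof (cases "(UNIV :: 'a set) = {0}")
    case True
    then have eq0: "x = 0" for x :: 'a by blast
    have "surj (V j)" for j by (metis surj_def eq0)
    \<comment> \<open>In the zero space no joint kernel is nonzero; the empty index set is taken, as
      every operator is onto.\<close>
    then show ?thesis using D.std_irred_rep_ker(2)[OF irr, of "{}"] True by blast
  next
    case False
    then show ?thesis using D.ex_wandering_indices[OF irr] D.std_irred_rep_ker(2)[OF irr] by metis
  qed
  show "irreducible_on UNIV (V ` {1..n})" if ex: "\<exists>A (W::'w::chilbert set) Ut. std_irred_rep n z V A W Ut"
  proof -
    obtain A and W :: "'w set" and Ut where "std_irred_rep n z V A W Ut" using ex by blast
    then obtain U where "std_rep n z V A W Ut U" by (rule std_irred_repE[OF D])
    then show ?thesis by (rule std_rep.irreducible)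
  qed
  fix V' :: "nat \<Rightarrow> 'b \<Rightarrow> 'b" and A and W :: "'w set" and Ut A' and W' :: "'w2 set" and Ut'
  assume *: "dnc_isometries n z V' \<and> (UNIV::'a set) \<noteq> {0} \<and> (UNIV::'b set) \<noteq> {0} \<and>
    irreducible_on UNIV (V ` {1..n}) \<and> irreducible_on UNIV (V' ` {1..n}) \<and>
    std_irred_rep n z V A W Ut \<and> std_irred_rep n z V' A' W' Ut'"
  then have irr: "irreducible_on UNIV (V ` {1..n})" "irreducible_on UNIV (V' ` {1..n})"
    and ne: "(UNIV::'a set) \<noteq> {0}" "(UNIV::'b set) \<noteq> {0}" by blast+
  have E: "dnc_tuple n z V'" using z_T * by (simp add: dnc_tuple_def)
  obtain U where "std_rep n z V A W Ut U"
    by (rule std_irred_repE[OF D, of A W Ut]) (use * in blast)+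
  then interpret R: std_rep n z V A W Ut U .
  obtain U' where "std_rep n z V' A' W' Ut' U'"
    by (rule std_irred_repE[OF E, of A' W' Ut']) (use * in blast)+
  then interpret R': std_rep n z V' A' W' Ut' U' .
  \<comment> \<open>Nontriviality of the space enters here: on the zero space the operators indexed
    by \<open>A\<close> would be onto as well.\<close>
  have A_eq: "A = {i \<in> {1..n}. \<not> surj (V i)}"
    using R.A R.surj_V R.not_surj_V[OF ne(1)] by blast
  have A'_eq: "A' = {i \<in> {1..n}. \<not> surj (V' i)}"
    using R'.A R'.surj_V R'.not_surj_V[OF ne(2)] by blast
  show "tuple_ueq n V V' \<longleftrightarrow> A = A' \<and> wandering_data_ueq n A V V'"
  proof
    assume ueq: "tuple_ueq n V V'"
    then have eq: "A = A'" using tuple_ueq_surj_iff[OF ueq] unfolding A_eq A'_eq by blast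
    moreover have "wandering_data_ueq n A V V'"
      using R.surj_V R'.surj_V eq by (intro tuple_ueq_imp_data_ueq[OF D E R.A _ _ ueq]) auto
    ultimately show "A = A' \<and> wandering_data_ueq n A V V'" ..
  next
    assume "A = A' \<and> wandering_data_ueq n A V V'"
    then have eq: "A' = A" and ueq: "wandering_data_ueq n A V V'" by blast+
    show "tuple_ueq n V V'"
      using R.surj_V R'.surj_V R.ker_nontrivial[OF ne(1)] R'.ker_nontrivial[OF ne(2)] unfolding eq
      by (intro data_ueq_imp_tuple_ueq[OF D E irr R.A _ _ _ _ ueq]) auto
  qed
qed

end
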